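(* For any group $G$, the inclusion map $G\wr\Sigma_n\to G\wr\Sigma_{n+1}$ induces an isomorphism on $H_i$ when $n\ge 2i+1$ and a surjection on $H_i$ when $n=2i$.
   Context: $\Sigma_n$ is the symmetric group on $n$ letters and $G\wr\Sigma_n=G^n\rtimes\Sigma_n$ is the wreath product, $\Sigma_n$ permuting the factors. The inclusion is the standard one, induced by $G^n\subset G^{n+1}$ (first $n$ factors) and $\Sigma_n\subset\Sigma_{n+1}$. Homology is with untwisted $\mathbb Z$ coefficients. *)

theory Defs
  imports "HOL-Algebra.Algebra"
begin

section \<open>Wreath products with symmetric groups\<close>

text \<open>
  The letters are \<open>1, \<dots>, n\<close>, and an element of \<open>G\<^sup>n\<close> is a function that is \<open>undefined\<close> outside
  \<open>{1..n}\<close>, as in \<^const>\<open>product_group\<close>. Permutations act on the left,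
  \<open>(\<sigma> \<cdot> h) i = h (\<sigma>\<inverse> i)\<close>, so that \<open>(g, \<sigma>) (h, \<tau>) = (g (\<sigma> \<cdot> h), \<sigma> \<tau>)\<close>.
\<close>

definition wreath_sym ::
  "('a, 'b) monoid_scheme \<Rightarrow> nat \<Rightarrow> ((nat \<Rightarrow> 'a) \<times> (nat \<Rightarrow> nat)) monoid" where
  "wreath_sym G n =
     \<lparr>carrier = carrier (product_group {1..n} (\<lambda>_. G)) \<times> carrier (sym_group n),
      monoid.mult = (\<lambda>(g, \<sigma>) (h, \<tau>).
        (g \<otimes>\<^bsub>product_group {1..n} (\<lambda>_. G)\<^esub> (\<lambda>i\<in>{1..n}. h (inv_into UNIV \<sigma> i)),
         \<sigma> \<otimes>\<^bsub>sym_group n\<^esub> \<tau>)),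
      one = (\<one>\<^bsub>product_group {1..n} (\<lambda>_. G)\<^esub>, \<one>\<^bsub>sym_group n\<^esub>)\<rparr>"

text \<open>
  A permutation of \<open>{1..n}\<close> is a function on all of \<^typ>\<open>nat\<close> fixing everything else, so it already
  is the corresponding permutation of \<open>{1..Suc n}\<close> fixing \<open>Suc n\<close>.
\<close>

definition wreath_sym_incl ::
  "('a, 'b) monoid_scheme \<Rightarrow> nat \<Rightarrow>
     (nat \<Rightarrow> 'a) \<times> (nat \<Rightarrow> nat) \<Rightarrow> (nat \<Rightarrow> 'a) \<times> (nat \<Rightarrow> nat)" where
  "wreath_sym_incl G n = (\<lambda>(g, \<sigma>). (g(Suc n := \<one>\<^bsub>G\<^esub>), \<sigma>))"

lemma group_wreath_sym:
  assumes "group G"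
  shows "group (wreath_sym G n)"
proof -
  interpret group G by fact
  have inv_perm: "inv_into UNIV p i \<in> {1..n} \<longleftrightarrow> i \<in> {1..n}" if "p permutes {1..n}" for p i
    using permutes_in_image[OF permutes_inv[OF that]] by simp
  show ?thesis
  proof (rule groupI)
    fix x y assume "x \<in> carrier (wreath_sym G n)" "y \<in> carrier (wreath_sym G n)"
    then show "x \<otimes>\<^bsub>wreath_sym G n\<^esub> y \<in> carrier (wreath_sym G n)"
      using inv_perm
      by (auto simp: wreath_sym_def sym_group_def permutes_compose PiE_iff
               simp del: atLeastAtMost_iff)
  next
    show "\<one>\<^bsub>wreath_sym G n\<^esub> \<in> carrier (wreath_sym G n)"
      by (auto simp: wreath_sym_def sym_group_def permutes_id)
  next
    fix x y z
    assume a: "x \<in> carrier (wreath_sym G n)" "y \<in> carrier (wreath_sym G n)"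
      "z \<in> carrier (wreath_sym G n)"
    obtain g p h q k r where e: "x = (g, p)" "y = (h, q)" "z = (k, r)" by (metis surj_pair)
    have p: "p permutes {1..n}" "q permutes {1..n}"
      and c: "\<And>i. i \<in> {1..n} \<Longrightarrow> g i \<in> carrier G \<and> h i \<in> carrier G \<and> k i \<in> carrier G"
      using a by (auto simp: e wreath_sym_def sym_group_def)
    have "inv_into UNIV (p \<circ> q) = inv_into UNIV q \<circ> inv_into UNIV p"
      using p by (simp add: o_inv_distrib permutes_bij)
    then show "x \<otimes>\<^bsub>wreath_sym G n\<^esub> y \<otimes>\<^bsub>wreath_sym G n\<^esub> z
        = x \<otimes>\<^bsub>wreath_sym G n\<^esub> (y \<otimes>\<^bsub>wreath_sym G n\<^esub> z)"
      using inv_perm[OF p(1)] inv_perm[OF p(2)] c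
      by (auto simp: e wreath_sym_def sym_group_def fun_eq_iff restrict_def m_assoc
               simp del: atLeastAtMost_iff)
  next
    fix x assume "x \<in> carrier (wreath_sym G n)"
    then show "\<one>\<^bsub>wreath_sym G n\<^esub> \<otimes>\<^bsub>wreath_sym G n\<^esub> x = x"
      by (auto simp: wreath_sym_def sym_group_def fun_eq_iff restrict_def PiE_iff extensional_def
               simp del: atLeastAtMost_iff)
  next
    fix x assume a: "x \<in> carrier (wreath_sym G n)"
    obtain g p where e: "x = (g, p)" by (metis surj_pair)
    have p: "p permutes {1..n}" and c: "\<And>i. i \<in> {1..n} \<Longrightarrow> g i \<in> carrier G"
      using a by (auto simp: e wreath_sym_def sym_group_def)
    have pin: "p i \<in> {1..n} \<longleftrightarrow> i \<in> {1..n}" for i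
      using permutes_in_image[OF p] by simp
    let ?y = "(\<lambda>i\<in>{1..n}. inv\<^bsub>G\<^esub> (g (p i)), inv_into UNIV p)"
    have "?y \<in> carrier (wreath_sym G n)"
      using c pin permutes_inv[OF p]
      by (auto simp: wreath_sym_def sym_group_def simp del: atLeastAtMost_iff)
    moreover have "?y \<otimes>\<^bsub>wreath_sym G n\<^esub> x = \<one>\<^bsub>wreath_sym G n\<^esub>"
      using c pin permutes_inv_o(2)[OF p]
      by (auto simp: e wreath_sym_def sym_group_def fun_eq_iff restrict_def
            inv_inv_eq[OF permutes_bij[OF p]] simp del: atLeastAtMost_iff)
    ultimately show "\<exists>y\<in>carrier (wreath_sym G n). y \<otimes>\<^bsub>wreath_sym G n\<^esub> x = \<one>\<^bsub>wreath_sym G n\<^esub>"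
      by blast
  qed
qed

lemma wreath_sym_incl_hom:
  assumes "group G"
  shows "wreath_sym_incl G n \<in> hom (wreath_sym G n) (wreath_sym G (Suc n))"
proof (rule homI)
  interpret group G by fact
  fix x assume "x \<in> carrier (wreath_sym G n)"
  then show "wreath_sym_incl G n x \<in> carrier (wreath_sym G (Suc n))"
    by (auto simp: wreath_sym_def wreath_sym_incl_def sym_group_def PiE_iff extensional_def
          le_Suc_eq intro: permutes_subset)
next
  interpret group G by fact
  fix x y assume a: "x \<in> carrier (wreath_sym G n)" "y \<in> carrier (wreath_sym G n)"
  obtain g p h q where e: "x = (g, p)" "y = (h, q)" by (metis surj_pair)
  have p: "p permutes {1..n}" using a by (auto simp: e wreath_sym_def sym_group_def)
  have "inv_into UNIV p i \<in> {1..n} \<longleftrightarrow> i \<in> {1..n}" for i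
    using permutes_in_image[OF permutes_inv[OF p]] by simp
  then have "inv_into UNIV p i \<noteq> Suc n" if "i \<in> {1..n}" for i
    using that by (metis atLeastAtMost_iff not_less_eq_eq order_refl)
  moreover have "inv_into UNIV p (Suc n) = Suc n"
    using permutes_inv[OF p] by (simp add: permutes_def)
  ultimately show "wreath_sym_incl G n (x \<otimes>\<^bsub>wreath_sym G n\<^esub> y)
      = wreath_sym_incl G n x \<otimes>\<^bsub>wreath_sym G (Suc n)\<^esub> wreath_sym_incl G n y"
    by (auto simp: e wreath_sym_def wreath_sym_incl_def sym_group_def fun_eq_iff restrict_def)
qed


section \<open>Integral group homology\<close>

text \<open>
  Homology with trivial coefficients \<open>\<int>\<close> is that of the inhomogeneous bar complex: in degree \<open>k\<close> the
  free abelian group on the symbols \<open>[g\<^sub>1|\<dots>|g\<^sub>k]\<close>, here lists of length \<open>k\<close>, with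
  \<open>\<partial>[g\<^sub>1|\<dots>|g\<^sub>k] = [g\<^sub>2|\<dots>|g\<^sub>k] + (\<Sum>0<j<k. (-1)\<^sup>j [g\<^sub>1|\<dots>|g\<^sub>j g\<^sub>j\<^sub>+\<^sub>1|\<dots>|g\<^sub>k]) + (-1)\<^sup>k [g\<^sub>1|\<dots>|g\<^sub>k\<^sub>-\<^sub>1]\<close>.
  List positions are counted from 0, so \<open>g\<^sub>j\<close> is \<open>gs ! (j - 1)\<close>.
\<close>

definition bar_chain_group :: "('a, 'b) monoid_scheme \<Rightarrow> nat \<Rightarrow> ('a list \<Rightarrow>\<^sub>0 int) monoid" where
  "bar_chain_group G k = free_Abelian_group {gs. length gs = k \<and> set gs \<subseteq> carrier G}"

definition bar_face :: "('a, 'b) monoid_scheme \<Rightarrow> nat \<Rightarrow> 'a list \<Rightarrow> 'a list" where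
  "bar_face G j gs =
     (if j = 0 then tl gs
      else if j = length gs then butlast gs
      else take (j - 1) gs @ (gs ! (j - 1) \<otimes>\<^bsub>G\<^esub> gs ! j) # drop (j + 1) gs)"

text \<open>The boundary vanishes on the empty list, the only generator in degree 0.\<close>

definition bar_boundary ::
  "('a, 'b) monoid_scheme \<Rightarrow> ('a list \<Rightarrow>\<^sub>0 int) \<Rightarrow> ('a list \<Rightarrow>\<^sub>0 int)" where
  "bar_boundary G = frag_extend (\<lambda>gs.
     if gs = [] then 0
     else \<Sum>j\<le>length gs. frag_cmul ((-1) ^ j) (frag_of (bar_face G j gs)))"

definition bar_cycle_group :: "('a, 'b) monoid_scheme \<Rightarrow> nat \<Rightarrow> ('a list \<Rightarrow>\<^sub>0 int) monoid" where
  "bar_cycle_group G k =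
     (bar_chain_group G k)\<lparr>carrier := {c \<in> carrier (bar_chain_group G k). bar_boundary G c = 0}\<rparr>"

definition bar_boundaries :: "('a, 'b) monoid_scheme \<Rightarrow> nat \<Rightarrow> ('a list \<Rightarrow>\<^sub>0 int) set" where
  "bar_boundaries G k = bar_boundary G ` carrier (bar_chain_group G (Suc k))"

definition group_homology ::
  "nat \<Rightarrow> ('a, 'b) monoid_scheme \<Rightarrow> ('a list \<Rightarrow>\<^sub>0 int) set monoid" where
  "group_homology k G = bar_cycle_group G k Mod bar_boundaries G k"

definition bar_chain_map :: "('a \<Rightarrow> 'c) \<Rightarrow> ('a list \<Rightarrow>\<^sub>0 int) \<Rightarrow> ('c list \<Rightarrow>\<^sub>0 int)" where
  "bar_chain_map f = frag_extend (\<lambda>gs. frag_of (map f gs))"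

text \<open>
  Homology classes are cosets. For a homomorphism \<open>f\<close> from \<open>G\<close> to \<open>H\<close>, all cycles \<open>z\<close> in the class \<open>C\<close>
  have images in the same coset, which \<^const>\<open>the_elem\<close> extracts.
\<close>

definition group_homology_map ::
  "nat \<Rightarrow> ('c, 'd) monoid_scheme \<Rightarrow> ('a \<Rightarrow> 'c) \<Rightarrow>
     ('a list \<Rightarrow>\<^sub>0 int) set \<Rightarrow> ('c list \<Rightarrow>\<^sub>0 int) set" where
  "group_homology_map k H f C =
     the_elem ((\<lambda>z. bar_boundaries H k #>\<^bsub>bar_cycle_group H k\<^esub> bar_chain_map f z) ` C)"


subsection \<open>The bar complex is a complex, functorial in the group\<close>

lemma length_bar_face: "j \<le> length gs \<Longrightarrow> length (bar_face G j gs) = length gs - 1"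
  by (auto simp: bar_face_def)

lemma nth_bar_face:
  assumes "j \<le> length gs" "p < length gs - 1"
  shows "bar_face G j gs ! p =
    (if p + 1 < j then gs ! p else if p + 1 = j then gs ! p \<otimes>\<^bsub>G\<^esub> gs ! (p + 1) else gs ! (p + 1))"
proof -
  consider "j = 0" | "j = length gs" "j \<noteq> 0" | "0 < j" "j < length gs"
    using assms(1) by linarith
  then show ?thesis
  proof cases
    case 3
    then obtain l where l: "j = Suc l" by (cases j) auto
    consider "p < l" | "p = l" | m where "p = l + Suc m"
      by (metis add_Suc_right less_iff_Suc_add linorder_neqE_nat)
    then show ?thesis
      using 3 assms(2) l by cases (simp_all add: bar_face_def nth_append)
  qed (use assms(2) in \<open>auto simp: bar_face_def nth_tl nth_butlast\<close>)
qed

lemma bar_face_closed: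
  assumes "group G" "set gs \<subseteq> carrier G" "j \<le> length gs"
  shows "set (bar_face G j gs) \<subseteq> carrier G"
proof -
  interpret group G by fact
  have "bar_face G j gs ! p \<in> carrier G" if "p < length gs - 1" for p
  proof -
    have "gs ! p \<in> carrier G" "gs ! (p + 1) \<in> carrier G"
      using assms(2) that by (auto intro!: subsetD[OF assms(2)] nth_mem)
    then show ?thesis using nth_bar_face[OF assms(3) that, of G] by auto
  qed
  then show ?thesis
    using assms(3) by (auto simp: in_set_conv_nth length_bar_face)
qed

lemma bar_face_bar_face:
  assumes "group G" "set gs \<subseteq> carrier G" "i < j" "j \<le> length gs"
  shows "bar_face G i (bar_face G j gs) = bar_face G (j - 1) (bar_face G i gs)"
proof (rule nth_equalityI)
  interpret group G by fact
  show "length (bar_face G i (bar_face G j gs)) = length (bar_face G (j - 1) (bar_face G i gs))"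
    using assms by (simp add: length_bar_face)
  fix p assume "p < length (bar_face G i (bar_face G j gs))"
  then have p: "p + 2 < length gs"
    using assms by (auto simp: length_bar_face)
  have c: "gs ! p \<in> carrier G" "gs ! (p + 1) \<in> carrier G" "gs ! (p + 2) \<in> carrier G"
    using p by (auto intro!: subsetD[OF assms(2)] nth_mem)
  show "bar_face G i (bar_face G j gs) ! p = bar_face G (j - 1) (bar_face G i gs) ! p"
    using assms p c by (auto simp: nth_bar_face length_bar_face m_assoc numeral_2_eq_2)
qed

lemma bar_boundary_of:
  "bar_boundary G (frag_of gs) =
    (if gs = [] then 0 else \<Sum>j\<le>length gs. frag_cmul ((-1) ^ j) (frag_of (bar_face G j gs)))"
  by (simp add: bar_boundary_def)

lemma bar_boundary_closed:
  assumes "group G" "c \<in> carrier (bar_chain_group G (Suc k))"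
  shows "bar_boundary G c \<in> carrier (bar_chain_group G k)"
proof -
  have "Poly_Mapping.keys (bar_boundary G c) \<subseteq> {gs. length gs = k \<and> set gs \<subseteq> carrier G}"
  proof -
    have "Poly_Mapping.keys (\<Sum>j\<le>length gs. frag_cmul ((-1) ^ j) (frag_of (bar_face G j gs)))
        \<subseteq> {gs. length gs = k \<and> set gs \<subseteq> carrier G}"
      if "gs \<in> Poly_Mapping.keys c" for gs
    proof -
      have gs: "length gs = Suc k" "set gs \<subseteq> carrier G"
        using assms(2) that by (auto simp: bar_chain_group_def)
      have "frag_cmul ((-1) ^ j) (frag_of (bar_face G j gs))
          \<in> carrier (free_Abelian_group {gs. length gs = k \<and> set gs \<subseteq> carrier G})"
        if "j \<le> length gs" for j
        using gs bar_face_closed[OF assms(1) gs(2) that] length_bar_face[OF that, of G]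
        by (auto dest: subsetD[OF keys_cmul])
      then have "(\<Sum>j\<le>length gs. frag_cmul ((-1) ^ j) (frag_of (bar_face G j gs)))
          \<in> carrier (free_Abelian_group {gs. length gs = k \<and> set gs \<subseteq> carrier G})"
        by (intro sum_closed_free_Abelian_group) simp
      then show ?thesis by simp
    qed
    then show ?thesis
      unfolding bar_boundary_def
      by (intro order_trans[OF keys_frag_extend] UN_least) simp
  qed
  then show ?thesis by (simp add: bar_chain_group_def)
qed

lemma bar_boundary_boundary_of:
  assumes "group G" "set gs \<subseteq> carrier G"
  shows "bar_boundary G (bar_boundary G (frag_of gs)) = 0"
proof (cases "length gs \<le> 1")
  case True
  then show ?thesis
    by (cases gs) (auto simp: bar_boundary_def bar_face_def frag_extend_diff)
next
  case False
  then obtain k where k: "length gs = Suc (Suc k)"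
    by (metis One_nat_def Suc_leI Suc_le_D linorder_not_less le_Suc_eq nat.exhaust)
  define F where "F = (\<lambda>(j, i). frag_cmul ((-1) ^ (i + j)) (frag_of (bar_face G i (bar_face G j gs))))"
  have "bar_boundary G (bar_boundary G (frag_of gs))
      = (\<Sum>j\<le>Suc (Suc k). \<Sum>i\<le>Suc k. F (j, i))"
  proof -
    have "bar_boundary G (frag_of (bar_face G j gs))
        = (\<Sum>i\<le>Suc k. frag_cmul ((-1) ^ i) (frag_of (bar_face G i (bar_face G j gs))))"
      if "j \<le> Suc (Suc k)" for j
    proof -
      have "length (bar_face G j gs) = Suc k" using k that by (simp add: length_bar_face)
      then show ?thesis unfolding bar_boundary_of by auto
    qed
    moreover have "bar_boundary G (bar_boundary G (frag_of gs))
        = (\<Sum>j\<le>Suc (Suc k). frag_cmul ((-1) ^ j) (bar_boundary G (frag_of (bar_face G j gs))))"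
    proof -
      have "gs \<noteq> []" using k by auto
      then show ?thesis
        unfolding bar_boundary_of[of G gs] k
        by (simp del: sum.atMost_Suc add: frag_extend_sum frag_extend_cmul bar_boundary_def o_def)
    qed
    ultimately show ?thesis
      by (simp del: sum.atMost_Suc add: F_def frag_cmul_sum power_add mult.commute)
  qed
  also have "\<dots> = sum F ({..Suc (Suc k)} \<times> {..Suc k})"
    by (simp only: sum.cartesian_product) simp
  also have "{..Suc (Suc k)} \<times> {..Suc k}
      = {(j, i). i < j \<and> j \<le> Suc (Suc k)} \<union> {(j, i). j \<le> i \<and> i \<le> Suc k}" (is "_ = ?A \<union> ?B")
    by auto
  also have "sum F (?A \<union> ?B) = sum F ?A + sum F ?B"
  proof (rule sum.union_disjoint)
    show "finite ?A" by (rule finite_subset[of _ "{..Suc (Suc k)} \<times> {..Suc k}"]) auto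
    show "finite ?B" by (rule finite_subset[of _ "{..Suc (Suc k)} \<times> {..Suc k}"]) auto
  qed auto
  also have "sum F ?A = (\<Sum>x\<in>?B. - F x)"
  proof (rule sum.reindex_bij_witness[of _ "\<lambda>(j, i). (Suc i, j)" "\<lambda>(j, i). (i, j - 1)"])
    fix x assume "x \<in> ?A"
    then obtain j i where x: "x = (Suc j, i)" "i \<le> j" "j \<le> Suc k"
      by (cases x; cases "fst x") auto
    then have "bar_face G i (bar_face G (Suc j) gs) = bar_face G j (bar_face G i gs)"
      using bar_face_bar_face[OF assms, of i "Suc j"] k by simp
    then show "- F (case x of (j, i) \<Rightarrow> (i, j - 1)) = F x"
      using x by (simp add: F_def add.commute flip: frag_cmul_minus_one)
  qed auto
  finally show ?thesis by (simp add: sum_negf)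
qed

lemma bar_boundary_boundary:
  assumes "group G" "c \<in> carrier (bar_chain_group G k)"
  shows "bar_boundary G (bar_boundary G c) = 0"
proof -
  have "Poly_Mapping.keys c \<subseteq> {gs. length gs = k \<and> set gs \<subseteq> carrier G}"
    using assms(2) by (simp add: bar_chain_group_def)
  then show ?thesis
  proof (induction c rule: frag_induction)
    case (one gs)
    then show ?case using bar_boundary_boundary_of[OF assms(1)] by simp
  next
    case (diff a b)
    then show ?case by (simp add: bar_boundary_def frag_extend_diff)
  qed (simp add: bar_boundary_def)
qed

lemma bar_chain_map_closed:
  assumes "f \<in> hom G H" "c \<in> carrier (bar_chain_group G k)"
  shows "bar_chain_map f c \<in> carrier (bar_chain_group H k)"
  using assms keys_frag_extend[of "\<lambda>gs. frag_of (map f gs)" c]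
  by (fastforce simp: bar_chain_map_def bar_chain_group_def hom_def Pi_iff)

lemma bar_chain_map_face:
  assumes "f \<in> hom G H" "set gs \<subseteq> carrier G" "j \<le> length gs"
  shows "map f (bar_face G j gs) = bar_face H j (map f gs)"
proof (rule nth_equalityI)
  show "length (map f (bar_face G j gs)) = length (bar_face H j (map f gs))"
    using assms by (simp add: length_bar_face)
  fix p assume "p < length (map f (bar_face G j gs))"
  then have p: "p < length gs - 1" using assms by (simp add: length_bar_face)
  then have "gs ! p \<in> carrier G" "gs ! (p + 1) \<in> carrier G"
    by (auto intro!: subsetD[OF assms(2)] nth_mem)
  then have "f (gs ! p \<otimes>\<^bsub>G\<^esub> gs ! (p + 1)) = f (gs ! p) \<otimes>\<^bsub>H\<^esub> f (gs ! (p + 1))"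
    by (rule hom_mult[OF assms(1)])
  then show "map f (bar_face G j gs) ! p = bar_face H j (map f gs) ! p"
    using assms p by (auto simp: nth_bar_face length_bar_face)
qed

lemma bar_chain_map_boundary:
  assumes "f \<in> hom G H" "c \<in> carrier (bar_chain_group G k)"
  shows "bar_boundary H (bar_chain_map f c) = bar_chain_map f (bar_boundary G c)"
proof -
  have "Poly_Mapping.keys c \<subseteq> {gs. length gs = k \<and> set gs \<subseteq> carrier G}"
    using assms(2) by (simp add: bar_chain_group_def)
  then show ?thesis
  proof (induction c rule: frag_induction)
    case (one gs)
    then show ?case
      using bar_chain_map_face[OF assms(1), of gs]
      by (simp add: bar_boundary_def bar_chain_map_def frag_extend_sum frag_extend_cmul o_def)
  next
    case (diff a b)
    then show ?case by (simp add: bar_boundary_def bar_chain_map_def frag_extend_diff)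
  qed (simp add: bar_boundary_def bar_chain_map_def)
qed

end

theory Submission
  imports Defs
begin

text \<open>
  Write \<open>\<Gamma>\<^sub>n\<close> for the wreath product of \<open>G\<close> with the symmetric group on \<open>n\<close> letters. It acts on the
  letters \<open>(i, a)\<close> with colour \<open>i \<in> {1..n}\<close> and label \<open>a \<in> G\<close>, by permuting the colours and multiplying
  the labels from the left. This action is transitive, and \<open>\<Gamma>\<^sub>n\<close> is the stabiliser of the letter
  \<open>(n + 1, 1)\<close> in \<open>\<Gamma>\<^sub>n\<^sub>+\<^sub>1\<close>. Hence \<open>\<Gamma>\<^sub>N\<close> acts transitively on the words of \<open>p\<close> letters with distinct colours,
  and \<open>\<Gamma>\<^sub>N\<^sub>-\<^sub>p\<close> is a point stabiliser. With deletion of letters as faces these words form a complex that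
  is exact in all lengths \<open>p < N\<close> (\<open>inj_words_acyclic\<close>): the complex of injective words, with labels.

  All \<open>\<Gamma>\<^sub>n\<close> are subgroups of the group of bijections of the set of letters, so tuples of bijections give
  one free resolution that serves all of them at once. The homology of \<open>\<Gamma>\<^sub>n\<close> is that of the coinvariants
  of this resolution, and stabilisation is induced by the identity on chains: only the subgroup of chains
  that count as zero grows with \<open>n\<close>. Coinvariants are therefore handled by congruences modulo \<open>nulls\<close>
  rather than as quotients.

  Pairs of a tuple and a word, modulo \<open>\<Gamma>\<^sub>N\<close>, form a double complex. Its rows are exact up to length \<open>N - 1\<close>
  (\<open>rows_exact\<close>), because \<open>\<Gamma>\<^sub>N\<close> acts freely on tuples. Its column \<open>p\<close> computes the homology of \<open>\<Gamma>\<^sub>N\<^sub>-\<^sub>p\<close>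
  (\<open>shapiro_surj\<close>, \<open>shapiro_inj\<close>). The horizontal map from column \<open>p\<close> to column \<open>p - 1\<close> is an alternating sum
  of \<open>p\<close> maps which all induce stabilisation \<open>\<Gamma>\<^sub>N\<^sub>-\<^sub>p \<rightarrow> \<Gamma>\<^sub>N\<^sub>-\<^sub>p\<^sub>+\<^sub>1\<close> in homology, as they differ by elements
  that commute with \<open>\<Gamma>\<^sub>N\<^sub>-\<^sub>p\<close>. So in homology it is stabilisation for odd \<open>p\<close> and zero for even \<open>p\<close>
  (\<open>dh_at_base_word\<close>). Suppose stability is known below degree \<open>q\<close>. Then the horizontal homology of the
  vertical homology vanishes where it matters (\<open>second_page_vanishes\<close>), and a diagram chase along the
  diagonal lifts vertical cycles along the horizontal map (\<open>lift_cycle\<close>). Applied in column 0 with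
  \<open>N = n + 1\<close> this yields surjectivity in degree \<open>q\<close>, and applied in column 1 it yields injectivity, since
  the map out of column 2 is zero in homology (\<open>stability\<close>).

  What remains is to identify these coinvariants with the bar complex: an equivariant retraction of all
  bijections onto \<open>\<Gamma>\<^sub>n\<close> turns tuples into bar symbols, and a prism shows that nothing is lost
  (\<open>of_bar_to_bar\<close>).
\<close>

section \<open>Finitely supported integral chains\<close>

definition free_chains :: "'x set \<Rightarrow> ('x \<Rightarrow>\<^sub>0 int) set" where
  "free_chains V = {c. Poly_Mapping.keys c \<subseteq> V}"

lemma chains_0 [simp]: "0 \<in> free_chains V"
  by (simp add: free_chains_def)

lemma chains_diff [intro]: "a \<in> free_chains V \<Longrightarrow> b \<in> free_chains V \<Longrightarrow> a - b \<in> free_chains V"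
  using keys_diff[of a b] by (auto simp: free_chains_def)

lemma chains_add [intro]: "a \<in> free_chains V \<Longrightarrow> b \<in> free_chains V \<Longrightarrow> a + b \<in> free_chains V"
  using Poly_Mapping.keys_add[of a b] by (auto simp: free_chains_def)

lemma chains_minus [intro]: "a \<in> free_chains V \<Longrightarrow> - a \<in> free_chains V"
  using chains_diff[of 0 V a] by simp

lemma frag_of_in_chains_iff [simp]: "frag_of x \<in> free_chains V \<longleftrightarrow> x \<in> V"
  by (simp add: free_chains_def)

lemma chains_mono: "c \<in> free_chains V \<Longrightarrow> V \<subseteq> Y \<Longrightarrow> c \<in> free_chains Y"
  by (auto simp: free_chains_def)

lemma chains_induct [consumes 1, case_names zero one diff]:
  assumes "c \<in> free_chains V" "P 0" "\<And>x. x \<in> V \<Longrightarrow> P (frag_of x)"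
    "\<And>a b. a \<in> free_chains V \<Longrightarrow> b \<in> free_chains V \<Longrightarrow> P a \<Longrightarrow> P b \<Longrightarrow> P (a - b)"
  shows "P c"
  using free_Abelian_group_induct[of c V P] assms by (auto simp: free_chains_def)

lemma frag_induct [case_names zero one diff]:
  assumes "P 0" "\<And>x. P (frag_of x)" "\<And>a b. P a \<Longrightarrow> P b \<Longrightarrow> P (a - b)"
  shows "P c"
  using chains_induct[of c UNIV P] assms by (auto simp: free_chains_def)

lemma frag_extend_chains:
  assumes "c \<in> free_chains V" "\<And>x. x \<in> V \<Longrightarrow> f x \<in> free_chains Y"
  shows "frag_extend f c \<in> free_chains Y"
  using assms(1) by (induction rule: chains_induct) (auto simp: frag_extend_diff assms(2))

lemma frag_extend_chains_cong:
  assumes "c \<in> free_chains V" "\<And>x. x \<in> V \<Longrightarrow> f x = g x"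
  shows "frag_extend f c = frag_extend g c"
  using assms by (intro frag_extend_eq) (auto simp: free_chains_def)

lemma frag_extend_frag_extend:
  "frag_extend f (frag_extend g c) = frag_extend (\<lambda>x. frag_extend f (g x)) c"
  by (induction c rule: frag_induct) (simp_all add: frag_extend_diff)

lemma frag_extend_zero_fun [simp]: "frag_extend (\<lambda>x. 0) c = 0"
  by (rule frag_extend_eq_0) simp

lemma frag_extend_minus_fun: "frag_extend (\<lambda>x. - f x) c = - frag_extend f c"
  by (induction c rule: frag_induct) (simp_all add: frag_extend_diff)

lemma frag_extend_diff_fun: "frag_extend (\<lambda>x. f x - g x) c = frag_extend f c - frag_extend g c"
  by (induction c rule: frag_induct) (simp_all add: frag_extend_diff)

lemma frag_extend_add_fun: "frag_extend (\<lambda>x. f x + g x) c = frag_extend f c + frag_extend g c"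
  by (induction c rule: frag_induct) (simp_all add: frag_extend_diff)

lemma frag_extend_swap:
  "frag_extend (\<lambda>x. frag_extend (f x) b) a = frag_extend (\<lambda>y. frag_extend (\<lambda>x. f x y) a) b"
  by (induction a rule: frag_induct) (simp_all add: frag_extend_diff frag_extend_diff_fun)

lemma frag_extend_frag_of [simp]: "frag_extend frag_of c = c"
  by (simp flip: frag_expansion)

lemma frag_cmul_diff_distrib2: "frag_cmul k (a - b) = frag_cmul k a - frag_cmul k b"
  by (rule poly_mapping_eqI) (simp add: lookup_minus algebra_simps)

lemma chains_cmul: "c \<in> free_chains A \<Longrightarrow> frag_cmul k c \<in> free_chains A"
  by (auto simp: free_chains_def)

abbreviation push :: "('x \<Rightarrow> 'y) \<Rightarrow> ('x \<Rightarrow>\<^sub>0 int) \<Rightarrow> ('y \<Rightarrow>\<^sub>0 int)" where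
  "push f \<equiv> frag_extend (\<lambda>x. frag_of (f x))"

lemmas frag_linear = frag_extend_diff frag_extend_add frag_extend_minus
lemmas frag_linear_fun = frag_extend_diff_fun frag_extend_add_fun frag_extend_minus_fun

section \<open>The simplicial boundary on lists\<close>

text \<open>
  The alternating sum of all deletions of one entry. The recursion is the cone formula
  \<open>\<partial>(x * c) = c - x * \<partial>c\<close>, which makes most identities below inductions on the list. Here the empty
  list counts as a simplex, so this is the augmented complex; it is the differential on words.
\<close>
primrec list_bd :: "'x list \<Rightarrow> 'x list \<Rightarrow>\<^sub>0 int" where
  "list_bd [] = 0"
| "list_bd (x # xs) = frag_of xs - push ((#) x) (list_bd xs)"

lemma list_bd_Cons_chain:
  "frag_extend list_bd (push ((#) x) c) = c - push ((#) x) (frag_extend list_bd c)"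
  by (simp add: frag_extend_frag_extend frag_linear_fun)

lemma list_bd_keys:
  "list_bd xs \<in> free_chains {take j xs @ drop (Suc j) xs |j. j < length xs}"
proof (induction xs)
  case (Cons x xs)
  show ?case unfolding list_bd.simps
  proof (intro chains_diff)
    show "frag_of xs \<in> free_chains {take j (x # xs) @ drop (Suc j) (x # xs) |j. j < length (x # xs)}"
      by (auto intro: exI[of _ 0])
    show "push ((#) x) (list_bd xs)
        \<in> free_chains {take j (x # xs) @ drop (Suc j) (x # xs) |j. j < length (x # xs)}"
    proof (rule frag_extend_chains[OF Cons.IH])
      fix ys assume "ys \<in> {take j xs @ drop (Suc j) xs |j. j < length xs}"
      then obtain j where "ys = take j xs @ drop (Suc j) xs" "j < length xs" by blast
      then show "frag_of (x # ys)
          \<in> free_chains {take j (x # xs) @ drop (Suc j) (x # xs) |j. j < length (x # xs)}"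
        by (auto intro!: exI[of _ "Suc j"])
    qed
  qed
qed simp

lemma list_bd_chains:
  assumes "\<And>j. j < length xs \<Longrightarrow> take j xs @ drop (Suc j) xs \<in> V"
  shows "list_bd xs \<in> free_chains V"
  by (rule chains_mono[OF list_bd_keys]) (use assms in auto)

lemma list_bd_list_bd [simp]: "frag_extend list_bd (list_bd xs) = 0"
proof (induction xs)
  case (Cons x xs)
  have "frag_extend (\<lambda>ys. push ((#) x) (list_bd ys)) (list_bd xs)
      = push ((#) x) (frag_extend list_bd (list_bd xs))"
    by (simp add: frag_extend_frag_extend)
  then show ?case using Cons by (simp add: frag_linear frag_extend_frag_extend frag_linear_fun)
qed simp

lemma list_bd_map: "list_bd (map f xs) = push (map f) (list_bd xs)"
  by (induction xs) (simp_all add: frag_linear frag_extend_frag_extend)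

text \<open>
  On tuples that represent group homology the differential must not be augmented, or the homology in
  degree 0 would be lost: one-element tuples have degree 0 and boundary 0.
\<close>
definition simplex_bd :: "'x list \<Rightarrow> 'x list \<Rightarrow>\<^sub>0 int" where
  "simplex_bd xs = (if length xs \<le> 1 then 0 else list_bd xs)"

lemma simplex_bd_map: "simplex_bd (map f xs) = push (map f) (simplex_bd xs)"
  by (simp add: simplex_bd_def list_bd_map)

abbreviation bd :: "('x list \<Rightarrow>\<^sub>0 int) \<Rightarrow> ('x list \<Rightarrow>\<^sub>0 int)" where
  "bd \<equiv> frag_extend simplex_bd"

definition tuples :: "nat \<Rightarrow> 'x set \<Rightarrow> 'x list set" where
  "tuples n V = {xs. length xs = n \<and> set xs \<subseteq> V}"

lemma list_bd_tuples:
  "xs \<in> tuples (Suc n) V \<Longrightarrow> list_bd xs \<in> free_chains (tuples n V)"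
  by (rule list_bd_chains) (auto simp: tuples_def dest: in_set_takeD in_set_dropD)

lemma simplex_bd_tuples:
  "xs \<in> tuples (Suc n) V \<Longrightarrow> simplex_bd xs \<in> free_chains (tuples n V)"
  by (auto simp: simplex_bd_def list_bd_tuples)

lemma bd_chains: "c \<in> free_chains (tuples (Suc n) V) \<Longrightarrow> bd c \<in> free_chains (tuples n V)"
  by (rule frag_extend_chains) (auto simp: simplex_bd_tuples)

lemma bd_simplex_bd [simp]: "bd (simplex_bd xs) = 0"
proof (cases "length xs \<le> 2")
  case True
  then have "list_bd xs \<in> free_chains {ys. length ys \<le> 1}"
    by (intro list_bd_chains) auto
  then have "bd (list_bd xs) = frag_extend (\<lambda>_. 0) (list_bd xs)"
    by (rule frag_extend_chains_cong) (auto simp: simplex_bd_def)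
  then show ?thesis by (simp add: simplex_bd_def)
next
  case False
  then have "list_bd xs \<in> free_chains {ys. length ys > 1}"
    by (intro list_bd_chains) auto
  then have "bd (list_bd xs) = frag_extend list_bd (list_bd xs)"
    by (rule frag_extend_chains_cong) (auto simp: simplex_bd_def)
  then show ?thesis by (simp add: simplex_bd_def)
qed

lemma bd_bd [simp]: "bd (bd c) = 0"
  by (simp add: frag_extend_frag_extend)

text \<open>
  The triangulation of the prism between the simplices \<open>map f xs\<close> and \<open>map g xs\<close>, again in cone form.
  Any two vertex maps into a full simplex are chain homotopic by it.
\<close>
primrec prism :: "('x \<Rightarrow> 'y) \<Rightarrow> ('x \<Rightarrow> 'y) \<Rightarrow> 'x list \<Rightarrow> 'y list \<Rightarrow>\<^sub>0 int" where
  "prism f g [] = 0"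
| "prism f g (x # xs) = frag_of (f x # g x # map g xs) - push ((#) (f x)) (prism f g xs)"

lemma prism_chains:
  "f ` set xs \<union> g ` set xs \<subseteq> V \<Longrightarrow> length xs = n \<Longrightarrow> prism f g xs \<in> free_chains (tuples (Suc n) V)"
proof (induction xs arbitrary: n)
  case (Cons x xs)
  then have "prism f g xs \<in> free_chains (tuples n V)" by auto
  then have "push ((#) (f x)) (prism f g xs) \<in> free_chains (tuples (Suc n) V)"
    by (rule frag_extend_chains) (use Cons.prems in \<open>auto simp: tuples_def\<close>)
  then show ?case using Cons.prems by (auto simp: tuples_def)
qed simp

lemma list_bd_prism:
  "frag_extend list_bd (prism f g xs) + frag_extend (prism f g) (list_bd xs)
    = frag_of (map g xs) - frag_of (map f xs)"
proof (induction xs)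
  case (Cons x xs)
  have eq: "frag_extend (\<lambda>ys. push ((#) (f x)) (list_bd ys)) (prism f g xs)
      + frag_extend (\<lambda>ys. push ((#) (f x)) (prism f g ys)) (list_bd xs)
      = push ((#) (f x)) (frag_of (map g xs) - frag_of (map f xs))"
    unfolding Cons[symmetric] by (simp add: frag_linear frag_extend_frag_extend)
  show ?case
    using eq by (simp add: frag_linear frag_extend_frag_extend frag_linear_fun list_bd_map algebra_simps)
qed simp

lemma bd_prism_simplex:
  "bd (prism f g xs) + frag_extend (prism f g) (simplex_bd xs)
    = frag_of (map g xs) - frag_of (map f xs)"
proof -
  have "bd (prism f g xs) = frag_extend list_bd (prism f g xs)"
  proof (cases xs)
    case (Cons a list)
    have "prism f g xs \<in> free_chains (tuples (Suc (length xs)) UNIV)"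
      by (rule prism_chains) auto
    then show ?thesis
      by (rule frag_extend_chains_cong) (auto simp: simplex_bd_def tuples_def Cons)
  qed simp
  moreover have "frag_extend (prism f g) (simplex_bd xs) = frag_extend (prism f g) (list_bd xs)"
  proof (cases "length xs \<le> 1")
    case True
    then have "list_bd xs \<in> free_chains {[]}" by (intro list_bd_chains) auto
    then have "frag_extend (prism f g) (list_bd xs) = frag_extend (\<lambda>_. 0) (list_bd xs)"
      by (rule frag_extend_chains_cong) auto
    then show ?thesis using True by (simp add: simplex_bd_def)
  qed (simp add: simplex_bd_def)
  ultimately show ?thesis by (simp add: list_bd_prism)
qed

lemma bd_prism:
  "push (map g) c - push (map f) c
    = bd (frag_extend (prism f g) c) + frag_extend (prism f g) (bd c)"
  by (simp only: frag_extend_frag_extend bd_prism_simplex flip: frag_linear_fun)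

text \<open>
  If the vertex maps are equivariant, so is the homotopy, and it passes to coinvariants.
\<close>
lemma prism_equivariant:
  assumes "\<And>x. x \<in> set xs \<Longrightarrow> f' (h x) = k (f x)" "\<And>x. x \<in> set xs \<Longrightarrow> g' (h x) = k (g x)"
  shows "prism f' g' (map h xs) = push (map k) (prism f g xs)"
  using assms by (induction xs) (simp_all add: frag_linear frag_extend_frag_extend o_def cong: map_cong)

section \<open>Coinvariants\<close>

text \<open>
  The kernel of the map from the free abelian group on \<open>V\<close> to its coinvariants, so that the coinvariants
  are chains modulo \<open>nulls\<close>. Congruence modulo this subgroup replaces the quotient throughout.
\<close>
inductive_set nulls :: "('s \<Rightarrow> 'x \<Rightarrow> 'x) \<Rightarrow> 's set \<Rightarrow> 'x set \<Rightarrow> ('x \<Rightarrow>\<^sub>0 int) set"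
  for act S V where
  zero [simp]: "0 \<in> nulls act S V"
| gen: "s \<in> S \<Longrightarrow> x \<in> V \<Longrightarrow> frag_of (act s x) - frag_of x \<in> nulls act S V"
| diff: "a \<in> nulls act S V \<Longrightarrow> b \<in> nulls act S V \<Longrightarrow> a - b \<in> nulls act S V"

lemma nulls_minus: "a \<in> nulls act S V \<Longrightarrow> - a \<in> nulls act S V"
  using nulls.diff[OF nulls.zero, of a act S V] by simp

lemma nulls_add: "a \<in> nulls act S V \<Longrightarrow> b \<in> nulls act S V \<Longrightarrow> a + b \<in> nulls act S V"
  using nulls.diff[OF _ nulls_minus, of a act S V b] by simp

lemma nulls_mono:
  assumes "c \<in> nulls act S V" "S \<subseteq> S'" "V \<subseteq> V'"
  shows "c \<in> nulls act S' V'"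
  using assms(1) by induction (use assms in \<open>auto intro: nulls.intros\<close>)

text \<open>
  A linear map descends to coinvariants as soon as it respects the generating relations. It need not be
  equivariant; the target relation \<open>D\<close> can be any subgroup.
\<close>
lemma nulls_frag_extend:
  assumes "c \<in> nulls act S V"
    and "0 \<in> D" "\<And>a b. a \<in> D \<Longrightarrow> b \<in> D \<Longrightarrow> a - b \<in> D"
    and "\<And>s x. s \<in> S \<Longrightarrow> x \<in> V \<Longrightarrow> f (act s x) - f x \<in> D"
  shows "frag_extend f c \<in> D"
  using assms(1) by induction (use assms in \<open>auto simp: frag_linear\<close>)

lemma nulls_frag_extend_nulls:
  assumes "c \<in> nulls act S V"
    and "\<And>s x. s \<in> S \<Longrightarrow> x \<in> V \<Longrightarrow> f (act s x) - f x \<in> nulls act' S' V'"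
  shows "frag_extend f c \<in> nulls act' S' V'"
  by (rule nulls_frag_extend[OF assms(1)]) (use assms(2) in \<open>auto intro: nulls.intros\<close>)

lemma push_diff_nulls:
  assumes "c \<in> free_chains V" "\<And>x. x \<in> V \<Longrightarrow> \<exists>s\<in>S. f x = act s x"
  shows "push f c - c \<in> nulls act S V"
  using assms(1)
proof (induction rule: chains_induct)
  case (diff a b)
  then have "(push f a - a) - (push f b - b) \<in> nulls act S V" by (rule_tac nulls.diff)
  then show ?case by (simp add: frag_linear algebra_simps)
next
  case (one x)
  then show ?case using assms(2)[of x] nulls.gen[of _ S x V act] by auto
qed simp

lemma push_nulls:
  assumes "c \<in> free_chains V" "s \<in> S"
  shows "push (act s) c - c \<in> nulls act S V"
  by (rule push_diff_nulls) (use assms in auto)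

lemma nulls_equivariant:
  assumes "c \<in> nulls act S V"
    and "\<And>x. x \<in> V \<Longrightarrow> f x \<in> free_chains V'"
    and "\<And>s x. s \<in> S \<Longrightarrow> x \<in> V \<Longrightarrow> f (act s x) = push (act' s) (f x)"
  shows "frag_extend f c \<in> nulls act' S V'"
  using assms(1) by (rule nulls_frag_extend_nulls) (auto simp: assms(2,3) intro: push_nulls)

section \<open>Operators on one factor of a product basis\<close>

text \<open>
  These are \<open>T \<otimes> id\<close> and \<open>id \<otimes> T\<close> on the tensor product of two free abelian groups, whose basis is the
  product of the bases.
\<close>
definition on_fst :: "('a \<Rightarrow> 'b \<Rightarrow>\<^sub>0 int) \<Rightarrow> ('a \<times> 'w \<Rightarrow>\<^sub>0 int) \<Rightarrow> ('b \<times> 'w \<Rightarrow>\<^sub>0 int)" where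
  "on_fst T = frag_extend (\<lambda>(e, w). push (\<lambda>x. (x, w)) (T e))"

definition on_snd :: "('w \<Rightarrow> 'v \<Rightarrow>\<^sub>0 int) \<Rightarrow> ('b \<times> 'w \<Rightarrow>\<^sub>0 int) \<Rightarrow> ('b \<times> 'v \<Rightarrow>\<^sub>0 int)" where
  "on_snd T = frag_extend (\<lambda>(e, w). push (Pair e) (T w))"

lemma on_fst_0 [simp]: "on_fst T 0 = 0" and on_snd_0 [simp]: "on_snd U 0 = 0"
  by (simp_all add: on_fst_def on_snd_def)

lemma on_fst_diff: "on_fst T (a - b) = on_fst T a - on_fst T b"
  by (simp add: on_fst_def frag_linear)

lemma on_snd_diff: "on_snd T (a - b) = on_snd T a - on_snd T b"
  and on_snd_add: "on_snd T (a + b) = on_snd T a + on_snd T b"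
  by (simp_all add: on_snd_def frag_linear)

lemma on_fst_push: "on_fst T (push (\<lambda>x. (x, w)) c) = push (\<lambda>x. (x, w)) (frag_extend T c)"
  by (simp add: on_fst_def frag_extend_frag_extend)

lemma on_snd_push: "on_snd T (push (Pair e) c) = push (Pair e) (frag_extend T c)"
  by (simp add: on_snd_def frag_extend_frag_extend)

lemma on_snd_push_fst:
   "on_snd T (push (\<lambda>x. (x, w)) c) = frag_extend (\<lambda>v. push (\<lambda>x. (x, v)) c) (T w)"
  unfolding on_snd_def frag_extend_frag_extend by (simp, subst frag_extend_swap) simp

lemma on_fst_on_snd: "on_fst T (on_snd U c) = on_snd U (on_fst T c)"
proof (induction c rule: frag_induct)
  case (one x)
  obtain e w where x: "x = (e, w)" by force
  have "on_fst T (on_snd U (frag_of x)) = frag_extend (\<lambda>v. push (\<lambda>y. (y, v)) (T e)) (U w)"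
    by (simp add: x on_fst_def on_snd_def frag_extend_frag_extend)
  also have "\<dots> = on_snd U (on_fst T (frag_of x))"
    by (simp add: x on_fst_def[of T] on_snd_push_fst)
  finally show ?case .
qed (simp_all add: on_fst_diff on_snd_diff)

lemma on_fst_on_fst: "on_fst T (on_fst U c) = on_fst (\<lambda>x. frag_extend T (U x)) c"
  unfolding on_fst_def frag_extend_frag_extend
  by (rule frag_extend_eq) (auto simp: frag_extend_frag_extend split: prod.splits)

lemma on_snd_on_snd: "on_snd T (on_snd U c) = on_snd (\<lambda>x. frag_extend T (U x)) c"
  unfolding on_snd_def frag_extend_frag_extend
  by (rule frag_extend_eq) (auto simp: frag_extend_frag_extend split: prod.splits)

text \<open>
  A direct sum of exact sequences is exact, where the complex in the second factor may depend on the
  basis element \<open>b\<close> in the first.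
\<close>
lemma on_snd_exact:
  assumes ex: "\<And>b c. b \<in> B \<Longrightarrow> c \<in> free_chains (V b) \<Longrightarrow> frag_extend T c = 0 \<Longrightarrow>
      \<exists>y\<in>free_chains (Y b). frag_extend U y = c"
    and z: "z \<in> free_chains (Sigma B V)" "on_snd T z = 0"
  shows "\<exists>y\<in>free_chains (Sigma B Y). on_snd U y = z"
proof -
  define part where "part b = (frag_extend (\<lambda>(b', w). if b' = b then frag_of w else 0)
    :: ('a \<times> 'b \<Rightarrow>\<^sub>0 int) \<Rightarrow> _)" for b
  define part' where "part' b = (frag_extend (\<lambda>(b', w). if b' = b then frag_of w else 0)
    :: ('a \<times> 'c \<Rightarrow>\<^sub>0 int) \<Rightarrow> _)" for b
  have part: "frag_extend T (part b c) = part' b (on_snd T c)" for b c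
    by (induction c rule: frag_induct)
      (auto simp: part_def part'_def on_snd_def frag_linear frag_extend_frag_extend)
  have "part b z \<in> free_chains (V b)" for b
    unfolding part_def by (rule frag_extend_chains[OF z(1)]) auto
  then have "\<exists>y\<in>free_chains (Y b). frag_extend U y = part b z" if "b \<in> B" for b
    using ex[OF that] part z(2) by (simp add: part'_def)
  then obtain y where y: "\<And>b. b \<in> B \<Longrightarrow> y b \<in> free_chains (Y b)"
    "\<And>b. b \<in> B \<Longrightarrow> frag_extend U (y b) = part b z" by metis
  define K where "K = fst ` Poly_Mapping.keys z"
  have K: "finite K" "K \<subseteq> B" using z(1) by (auto simp: K_def free_chains_def)
  have sum: "(\<Sum>b\<in>K. push (Pair b) (part b c)) = c" if "c \<in> free_chains (K \<times> UNIV)" for c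
    using that
  proof (induction rule: chains_induct)
    case (one x)
    obtain b w where x: "x = (b, w)" by force
    have "(\<Sum>b\<in>K. push (Pair b) (part b (frag_of x))) = (\<Sum>b'\<in>K. if b = b' then frag_of (b', w) else 0)"
      by (intro sum.cong) (auto simp: part_def x)
    then show ?case using one K by (simp add: x)
  qed (simp_all add: part_def frag_linear sum_subtractf)
  let ?y = "\<Sum>b\<in>K. push (Pair b) (y b)"
  have "?y \<in> free_chains (Sigma B Y)"
  proof -
    have "push (Pair b) (y b) \<in> free_chains (Sigma B Y)" if "b \<in> K" for b
      by (rule frag_extend_chains[OF y(1)]) (use K that in auto)
    then show ?thesis
      using K(1) by (induction K rule: infinite_finite_induct) auto
  qed
  moreover have "on_snd U ?y = (\<Sum>b\<in>K. on_snd U (push (Pair b) (y b)))"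
    using K(1) by (induction rule: finite_induct) (simp_all add: on_snd_add)
  moreover have "\<dots> = (\<Sum>b\<in>K. push (Pair b) (part b z))"
    using K y by (intro sum.cong) (auto simp: on_snd_push)
  moreover have "z \<in> free_chains (K \<times> UNIV)" by (force simp: free_chains_def K_def)
  ultimately show ?thesis using sum by force
qed

section \<open>The complex of injective words is acyclic below the top\<close>

definition inj_words :: "'c set \<Rightarrow> 'l set \<Rightarrow> nat \<Rightarrow> ('c \<times> 'l) list set" where
  "inj_words C L p = {w. length w = p \<and> set w \<subseteq> C \<times> L \<and> distinct (map fst w)}"

lemma delete_inj_words:
  assumes "w \<in> inj_words C L (Suc p)" "j < length w"
  shows "take j w @ drop (Suc j) w \<in> inj_words C L p"
proof -
  have "distinct (take j (map fst w) @ map fst w ! j # drop (Suc j) (map fst w))"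
    using assms id_take_nth_drop[of j "map fst w"] unfolding inj_words_def by simp
  then have "distinct (take j (map fst w) @ drop (Suc j) (map fst w))"
    by simp
  then show ?thesis
    using assms unfolding inj_words_def
    by (auto simp: take_map drop_map dest: in_set_takeD in_set_dropD)
qed

lemma list_bd_inj_words:
  "w \<in> inj_words C L (Suc p) \<Longrightarrow> list_bd w \<in> free_chains (inj_words C L p)"
  by (rule list_bd_chains) (rule delete_inj_words)

lemma inj_words_append:
  assumes "v @ t \<in> inj_words C L p"
  shows "v \<in> inj_words C L (length v)" "t \<in> inj_words (C - fst ` set v) L (p - length v)"
proof -
  have vt: "length v + length t = p" "set v \<union> set t \<subseteq> C \<times> L" "distinct (map fst v)"
    "distinct (map fst t)" "fst ` set v \<inter> fst ` set t = {}"
    using assms by (auto simp: inj_words_def)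
  then show "v \<in> inj_words C L (length v)" by (simp add: inj_words_def)
  have "x \<in> (C - fst ` set v) \<times> L" if "x \<in> set t" for x
  proof -
    have "fst x \<notin> fst ` set v" using vt(5) that by blast
    then show ?thesis using vt(2) that by (cases x) auto
  qed
  then show "t \<in> inj_words (C - fst ` set v) L (p - length v)"
    using vt by (auto simp: inj_words_def)
qed

lemma fst_in_words: "t \<in> inj_words C L q \<Longrightarrow> fst ` set t \<subseteq> C"
  by (auto simp: inj_words_def)

lemma append_inj_words:
  assumes v: "v \<in> inj_words C L m" and t: "t \<in> inj_words (C - fst ` set v) L q"
  shows "v @ t \<in> inj_words C L (m + q)"
proof -
  have "fst ` set v \<inter> fst ` set t = {}" using fst_in_words[OF t] by blast
  moreover have "set t \<subseteq> C \<times> L" using t by (auto simp: inj_words_def)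
  ultimately show ?thesis using v t by (auto simp: inj_words_def)
qed

text \<open>
  The component of a chain on those words whose letter of colour \<open>a\<close> stands at index \<open>k\<close>, with each such
  word cut just behind that letter.
\<close>
definition split_at_colour :: "'c \<Rightarrow> nat \<Rightarrow> ('c \<times> 'l) list \<Rightarrow> ('c \<times> 'l) list \<times> ('c \<times> 'l) list \<Rightarrow>\<^sub>0 int" where
  "split_at_colour a k w = (if k < length w
      \<and> fst (w ! k) = a then frag_of (take (Suc k) w, drop (Suc k) w) else 0)"

lemma split_at_colour_Cons_Suc: "split_at_colour a (Suc k) (x # xs)
    = push (\<lambda>(v, t). (x # v, t)) (split_at_colour a k xs)"
  by (simp add: split_at_colour_def)

lemma split_at_colour_absent: "a \<notin> fst ` set w \<Longrightarrow> split_at_colour a k w = 0"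
  by (auto simp: split_at_colour_def)

text \<open>
  Let no letter of colour \<open>a\<close> stand behind index \<open>k\<close>. A deletion can keep this letter at index \<open>k\<close> only if
  it happens behind the letter, since deleting an earlier letter moves it to the left and deleting the
  letter itself removes the colour. So on this component the boundary acts on the second part alone, up
  to the sign of the first \<open>k + 1\<close> positions.
\<close>
lemma split_at_colour_list_bd:
  assumes "distinct (map fst w)" "a \<notin> fst ` set (drop (Suc k) w)"
  shows "frag_extend (split_at_colour a k) (list_bd w)
      = frag_cmul ((-1) ^ Suc k) (on_snd list_bd (split_at_colour a k w))"
  using assms
proof (induction w arbitrary: k)
  case Nil
  then show ?case by (simp add: split_at_colour_def)
next
  case (Cons x xs)
  show ?case
  proof (cases k)
    case 0
    have "split_at_colour a 0 xs = 0"
      using Cons.prems 0 by (simp add: split_at_colour_absent)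
    moreover have "split_at_colour a 0 (x # ys) = (if fst x = a then frag_of ([x], ys) else 0)" for ys
      by (auto simp: split_at_colour_def)
    ultimately show ?thesis
      using 0 by (auto simp: frag_linear frag_extend_frag_extend on_snd_def split_at_colour_def)
  next
    case (Suc l)
    have 1: "split_at_colour a (Suc l) xs = 0"
      using Cons.prems Suc
      by (auto simp: split_at_colour_def simp flip: Cons_nth_drop_Suc)
    have 3: "push (\<lambda>(v, t). (x # v, t)) (on_snd list_bd c)
        = on_snd list_bd (push (\<lambda>(v, t). (x # v, t)) c)"
        for c :: "('a \<times> 'b) list \<times> ('a \<times> 'b) list \<Rightarrow>\<^sub>0 int"
      unfolding on_snd_def frag_extend_frag_extend
      by (rule frag_extend_eq) (auto simp: frag_extend_frag_extend)
    have "frag_extend (split_at_colour a l) (list_bd xs)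
        = frag_cmul ((-1) ^ Suc l) (on_snd list_bd (split_at_colour a l xs))"
      using Cons.prems Suc by (intro Cons.IH) auto
    note IH = this
    have "frag_extend (split_at_colour a (Suc l)) (list_bd (x # xs))
        = - push (\<lambda>(v, t). (x # v, t)) (frag_extend (split_at_colour a l) (list_bd xs))"
      by (simp add: 1 frag_linear frag_extend_frag_extend split_at_colour_Cons_Suc)
    then show ?thesis
      unfolding IH Suc by (simp add: split_at_colour_Cons_Suc frag_extend_cmul 3 del: list_bd.simps)
  qed
qed

text \<open>
  Fix a colour \<open>a\<close> and filter the words by the position of the letter of colour \<open>a\<close>. Words without this
  colour are coned off by one letter of colour \<open>a\<close>. The words \<open>v @ t\<close> in which that letter is the last
  one of a fixed prefix \<open>v\<close> contribute, up to a shift by \<open>length v\<close>, the complex of injective words in the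
  colours that do not occur in \<open>v\<close>, and both the number of colours and the length drop by \<open>length v\<close>. So the
  induction hypothesis applies to these words, whatever labels their letters carry.
\<close>
lemma inj_words_acyclic:
  fixes C :: "'c set" and L :: "'l set"
  assumes "finite C" "L \<noteq> {}" "p < card C"
    and "z \<in> free_chains (inj_words C L p)" "frag_extend list_bd z = 0"
  shows "\<exists>y\<in>free_chains (inj_words C L (Suc p)). frag_extend list_bd y = z"
  using assms
proof (induction "card C" arbitrary: C p z rule: less_induct)
  case less
  obtain a where a: "a \<in> C" using less.prems(3) by fastforce
  obtain l where l: "l \<in> L" using less.prems(2) by blast
  \<comment> \<open>the letter of colour \<open>a\<close>, if present, has an index below \<open>k\<close>\<close>
  define W where "W p k = {w \<in> inj_words C L p. a \<notin> fst ` set (drop k w)}" for p k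
  have bd_W: "frag_extend list_bd c \<in> free_chains (W p k)" if "c \<in> free_chains (W (Suc p) k)" for c p k
    using that
  proof (rule frag_extend_chains)
    fix w assume w: "w \<in> W (Suc p) k"
    show "list_bd w \<in> free_chains (W p k)"
    proof (rule list_bd_chains)
      fix j assume j: "j < length w"
      have "set (drop k (take j w @ drop (Suc j) w)) \<subseteq> set (drop k w)"
      proof (cases "k \<le> j")
        case True
        then have "set (drop (Suc j) w) \<subseteq> set (drop k w)"
          by (intro set_drop_subset_set_drop) simp
        moreover have "set (drop k (take j w)) \<subseteq> set (drop k w)"
          unfolding drop_take by (rule set_take_subset)
        moreover have "drop k (take j w @ drop (Suc j) w) = drop k (take j w) @ drop (Suc j) w"
          using True j by simp
        ultimately show ?thesis by (metis Un_least set_append)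
      next
        case False
        then show ?thesis using j
          by (auto simp: intro: set_drop_subset_set_drop[THEN subsetD, rotated])
      qed
      then show "take j w @ drop (Suc j) w \<in> W p k"
        using w delete_inj_words[of w C L p j] j by (auto simp: W_def)
    qed
  qed
  have W_all: "z \<in> free_chains (W p k) \<Longrightarrow> frag_extend list_bd z = 0 \<Longrightarrow>
      \<exists>y\<in>free_chains (inj_words C L (Suc p)). frag_extend list_bd y = z" for k z
  proof (induction k arbitrary: z)
    case 0
    \<comment> \<open>the colour \<open>a\<close> is absent from \<open>z\<close>, so \<open>z\<close> bounds its cone\<close>
    have "push ((#) (a, l)) z \<in> free_chains (inj_words C L (Suc p))"
      by (rule frag_extend_chains[OF 0(1)]) (use a l in \<open>auto simp: W_def inj_words_def\<close>)
    then show ?case using 0 list_bd_Cons_chain[of "(a, l)" z] by (auto intro!: bexI)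
  next
    case (Suc k)
    show ?case
    proof (cases "k < p")
      case False
      then have "W p (Suc k) = W p k" by (auto simp: W_def inj_words_def)
      then show ?thesis using Suc by simp
    next
      case True
      define B where "B = {v \<in> inj_words C L (Suc k). fst (last v) = a}"
      define V where "V q v = inj_words (C - fst ` set v) L q" for q and v :: "('c \<times> 'l) list"
      have cut_in: "split_at_colour a k w \<in> free_chains (Sigma B (V (p - Suc k)))"
          if "w \<in> W p (Suc k)" for w
      proof (cases "k < length w \<and> fst (w ! k) = a")
        case True
        define v t where "v = take (Suc k) w" and "t = drop (Suc k) w"
        have w: "w = v @ t" "length v = Suc k" using True by (simp_all add: v_def t_def)
        have "v @ t \<in> inj_words C L p" using that w(1) by (simp add: W_def)
        then have "v \<in> inj_words C L (Suc k)" "t \<in> V (p - Suc k) v"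
          using w(2) inj_words_append[of v t C L p] by (auto simp: V_def)
        then have "take (Suc k) w \<in> inj_words C L (Suc k)"
            "drop (Suc k) w \<in> V (p - Suc k) (take (Suc k) w)"
          by (simp_all add: v_def t_def)
        moreover have "fst (last (take (Suc k) w)) = a"
          using True by (simp add: take_Suc_conv_app_nth)
        ultimately show ?thesis using True by (auto simp: split_at_colour_def B_def)
      qed (auto simp: split_at_colour_def)
      have "frag_extend (split_at_colour a k) (frag_extend list_bd c)
          = frag_cmul ((-1) ^ Suc k) (on_snd list_bd (frag_extend (split_at_colour a k) c))"
              if "c \<in> free_chains (W q (Suc k))" for c q
        using that
      proof (induction rule: chains_induct)
        case (one w)
        then show ?case using split_at_colour_list_bd[of w a k] by (simp add: W_def inj_words_def)
      next
        case (diff a b)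
        then show ?case
          by (simp add: frag_linear on_snd_diff frag_cmul_diff_distrib2 del: power_Suc)
      qed simp
      note cut_bd = this
      have "on_snd list_bd (frag_extend (split_at_colour a k) z) = 0"
        using cut_bd[OF Suc.prems(1)] Suc.prems(2) by simp
      moreover have "frag_extend (split_at_colour a k) z \<in> free_chains (Sigma B (V (p - Suc k)))"
        by (rule frag_extend_chains[OF Suc.prems(1)]) (rule cut_in)
      moreover have "\<exists>y\<in>free_chains (V (Suc (p - Suc k)) v). frag_extend list_bd y = c"
        if v: "v \<in> B" "c \<in> free_chains (V (p - Suc k) v)" "frag_extend list_bd c = 0" for v c
      proof -
        have "card (fst ` set v) = Suc k" "fst ` set v \<subseteq> C"
          using v(1) distinct_card[of "map fst v"] by (auto simp: B_def inj_words_def)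
        then have card: "card (C - fst ` set v) = card C - Suc k"
          using less.prems(1) by (simp add: card_Diff_subset)
        show ?thesis unfolding V_def
          by (rule less.hyps) (use v card less.prems True in \<open>auto simp: V_def\<close>)
      qed
      ultimately obtain y where y: "y \<in> free_chains (Sigma B (V (Suc (p - Suc k))))"
          "on_snd list_bd y = frag_extend (split_at_colour a k) z"
        using on_snd_exact[of B "V (p - Suc k)" list_bd "V (Suc (p - Suc k))" list_bd] by blast
      define j where "j = push (\<lambda>(v, t). v @ t) y"
      have j: "j \<in> free_chains (W (Suc p) (Suc k))"
        unfolding j_def
      proof (rule frag_extend_chains[OF y(1)])
        fix x assume "x \<in> Sigma B (V (Suc (p - Suc k)))"
        then obtain v t where x: "x = (v, t)" "v \<in> B" "t \<in> V (Suc (p - Suc k)) v" by blast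
        have "a \<in> fst ` set v" using x(2)
          by (auto simp: B_def inj_words_def intro!: image_eqI[of _ _ "last v"] last_in_set)
        then have "a \<notin> fst ` set t"
          using fst_in_words[of t "C - fst ` set v"] x(3) by (auto simp: V_def)
        moreover have "v @ t \<in> inj_words C L (Suc k + Suc (p - Suc k))"
          by (rule append_inj_words) (use x in \<open>simp_all add: B_def V_def\<close>)
        moreover have "length v = Suc k" using x(2) by (simp add: B_def inj_words_def)
        ultimately show "frag_of (case x of (v, t) \<Rightarrow> v @ t) \<in> free_chains (W (Suc p) (Suc k))"
          using x(1) True by (simp add: W_def)
      qed
      have cut_j: "frag_extend (split_at_colour a k) j = y"
      proof -
        have "frag_extend (split_at_colour a k) j = frag_extend frag_of y"
          unfolding j_def frag_extend_frag_extend
        proof (rule frag_extend_chains_cong[OF y(1)])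
          fix x assume "x \<in> Sigma B (V (Suc (p - Suc k)))"
          then obtain v t where x: "x = (v, t)" "v \<in> B" by blast
          then have "length v = Suc k" "fst (last v) = a" by (auto simp: B_def inj_words_def)
          then have "(v @ t) ! k = last v"
            using last_conv_nth[of v] by (cases "v = []") (simp_all add: nth_append)
          then show "frag_extend (split_at_colour a k) (frag_of (case x of (v, t) \<Rightarrow> v @ t)) = frag_of x"
            using x \<open>length v = Suc k\<close> \<open>fst (last v) = a\<close> by (simp add: split_at_colour_def)
        qed
        then show ?thesis by simp
      qed
      define e :: int where "e = (-1) ^ Suc k"
      have e: "e * e = 1" by (simp add: e_def flip: power_mult_distrib)
      \<comment> \<open>removes exactly the words whose letter of colour \<open>a\<close> has index \<open>k\<close>\<close>
      define z1 where "z1 = z - frag_cmul e (frag_extend list_bd j)"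
      have z1: "z1 \<in> free_chains (W p (Suc k))" unfolding z1_def
        by (intro chains_diff chains_cmul bd_W j Suc.prems)
      have "frag_extend (split_at_colour a k) z1 = 0"
        unfolding z1_def frag_linear frag_extend_cmul cut_bd[OF j] cut_j y(2) e_def[symmetric]
            by (simp add: e)
      moreover have "z1 = frag_extend (\<lambda>w. if k < length w \<and> fst (w ! k) = a then 0 else frag_of w) z1
          + push (\<lambda>(v, t). v @ t) (frag_extend (split_at_colour a k) z1)"
      proof -
        have "z1 = frag_extend frag_of z1" by simp
        also have "\<dots> = frag_extend (\<lambda>w. (if k < length w \<and> fst (w ! k) = a then 0 else frag_of w)
            + push (\<lambda>(v, t). v @ t) (split_at_colour a k w)) z1"
          by (rule frag_extend_eq) (simp add: split_at_colour_def)
        finally show ?thesis by (simp only: frag_linear_fun frag_extend_frag_extend)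
      qed
      ultimately have "z1 = frag_extend (\<lambda>w. if k < length w \<and> fst (w ! k) = a then 0 else frag_of w) z1"
        by simp
      moreover have "\<dots> \<in> free_chains (W p k)"
      proof (rule frag_extend_chains[OF z1])
        fix w assume w: "w \<in> W p (Suc k)"
        then have "drop k w = (if k < length w then [w ! k] else []) @ drop (Suc k) w"
          by (simp add: Cons_nth_drop_Suc)
        then show "(if k < length w \<and> fst (w ! k) = a then 0 else frag_of w) \<in> free_chains (W p k)"
          using w by (auto simp: W_def)
      qed
      ultimately have "z1 \<in> free_chains (W p k)" by simp
      moreover have "frag_extend list_bd z1 = 0"
        using Suc.prems(2) by (simp add: z1_def frag_linear frag_extend_cmul
            frag_extend_frag_extend[of list_bd])
      ultimately obtain y1 where "y1 \<in> free_chains (inj_words C L (Suc p))" "frag_extend list_bd y1 = z1"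
        using Suc.IH by blast
      moreover have "j \<in> free_chains (inj_words C L (Suc p))"
        by (rule chains_mono[OF j]) (auto simp: W_def)
      ultimately show ?thesis
        by (intro bexI[of _ "y1 + frag_cmul e j"])
          (auto simp: frag_linear frag_extend_cmul z1_def intro: chains_cmul)
    qed
  qed
  have "z \<in> free_chains (W p p)"
    by (rule chains_mono[OF less.prems(4)]) (auto simp: W_def inj_words_def)
  then show ?case using W_all less.prems(5) by blast
qed

lemma comp_bij_cancel:
  assumes "bij e" "f \<circ> e = g \<circ> e"
  shows "f = g"
proof
  fix x
  obtain y where "x = e y" using bij_is_surj[OF assms(1)] by (metis surjD)
  then show "f x = g x" using fun_cong[OF assms(2), of y] by simp
qed

section \<open>Tuples of bijections as a free resolution\<close>

text \<open>
  Any group of bijections acts freely on the set of all bijections by composition from the left, because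
  a bijection can be cancelled. Therefore the tuples of bijections are a free resolution for every such
  group.
\<close>
definition bijections :: "('x \<Rightarrow> 'x) set" where "bijections = {f. bij f}"

abbreviation left_mult :: "('x \<Rightarrow> 'x) \<Rightarrow> ('x \<Rightarrow> 'x) list \<Rightarrow> ('x \<Rightarrow> 'x) list"
  where "left_mult s \<equiv> map ((\<circ>) s)"

definition frames :: "('x \<Rightarrow> 'x) list set" where
  "frames = {es. es \<noteq> [] \<and> set es \<subseteq> bijections}"

definition frame_chains :: "nat \<Rightarrow> (('x \<Rightarrow> 'x) list \<Rightarrow>\<^sub>0 int) set" where
  "frame_chains q = free_chains (tuples (Suc q) bijections)"

lemma left_mult_id: "left_mult id es = es"
  by (rule map_idI) simp

lemma tuples_frames: "tuples (Suc q) bijections \<subseteq> frames"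
  by (auto simp: tuples_def frames_def)

lemma frames_tuples: "es \<in> frames \<Longrightarrow> es \<in> tuples (Suc (length es - 1)) bijections"
  by (auto simp: tuples_def frames_def Suc_diff_1)

lemma simplex_bd_frames:
  assumes "es \<in> frames"
  shows "simplex_bd es \<in> free_chains frames"
proof (cases "length es - 1")
  case 0
  then show ?thesis by (simp add: simplex_bd_def)
next
  case (Suc q)
  then have "simplex_bd es \<in> free_chains (tuples (Suc q) bijections)"
    using frames_tuples[OF assms] by (intro simplex_bd_tuples) simp
  then show ?thesis by (rule chains_mono) (rule tuples_frames)
qed

lemma frame_chains_frames: "c \<in> frame_chains q \<Longrightarrow> c \<in> free_chains frames"
  unfolding frame_chains_def by (rule chains_mono) (auto intro: tuples_frames[THEN subsetD])

lemma frame_chains_diff: "a \<in> frame_chains q \<Longrightarrow> b \<in> frame_chains q \<Longrightarrow> a - b \<in> frame_chains q"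
  and frame_chains_add: "a \<in> frame_chains q \<Longrightarrow> b \<in> frame_chains q \<Longrightarrow> a + b \<in> frame_chains q"
      and frame_chains_0 [simp]: "0 \<in> frame_chains q"
  by (auto simp: frame_chains_def)

lemma bd_frame_chains: "c \<in> frame_chains (Suc q) \<Longrightarrow> bd c \<in> frame_chains q"
  by (simp add: frame_chains_def bd_chains)

lemma bd_frames: "c \<in> free_chains frames \<Longrightarrow> bd c \<in> free_chains frames"
  by (rule frag_extend_chains) (auto simp: simplex_bd_frames)

section \<open>Stability for groups acting on coloured letters\<close>

type_synonym 'l letter_map = "nat \<times> 'l \<Rightarrow> nat \<times> 'l"

text \<open>
  What stability needs from the groups \<open>S m\<close>. They are nested groups of bijections of the letters that act
  on the first \<open>m\<close> colours, transitively on letters, and the stabiliser of the next base letter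
  \<open>(m + 1, u)\<close> is the previous group. The last condition provides an element which moves the base letter
  of colour \<open>m + 1\<close> to the next one and commutes with \<open>S m\<close>, as it fixes the first \<open>m\<close> colours.
\<close>
locale letter_groups =
  fixes L :: "'l set" and u :: 'l and S :: "nat \<Rightarrow> 'l letter_map set"
  assumes u_in: "u \<in> L"
    and id_in: "id \<in> S m"
    and comp_in: "s \<in> S m \<Longrightarrow> t \<in> S m \<Longrightarrow> s \<circ> t \<in> S m"
    and inverse_in: "s \<in> S m \<Longrightarrow> \<exists>t\<in>S m. t \<circ> s = id \<and> s \<circ> t = id"
    and S_Suc: "S m \<subseteq> S (Suc m)"
    and fixes_outside: "s \<in> S m \<Longrightarrow> fst l \<notin> {1..m} \<Longrightarrow> s l = l"
    and maps_letters: "s \<in> S m \<Longrightarrow> l \<in> {1..m} \<times> L \<Longrightarrow> s l \<in> {1..m} \<times> L"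
    and colour_inj: "s \<in> S m \<Longrightarrow> l \<in> {1..m} \<times> L \<Longrightarrow> l' \<in> {1..m} \<times> L \<Longrightarrow>
      fst (s l) = fst (s l') \<Longrightarrow> fst l = fst l'"
    and stabiliser: "s \<in> S (Suc m) \<Longrightarrow> s (Suc m, u) = (Suc m, u) \<Longrightarrow> s \<in> S m"
    and transitive: "l \<in> {1..Suc m} \<times> L \<Longrightarrow> \<exists>s\<in>S (Suc m). s l = (Suc m, u)"
    and swap: "\<exists>s\<in>S (Suc (Suc m)). (\<forall>l. fst l \<le> m \<longrightarrow> s l = l) \<and> s (Suc m, u) = (Suc (Suc m), u)"
begin

definition frame_nulls :: "nat \<Rightarrow> ('l letter_map list \<Rightarrow>\<^sub>0 int) set" where
  "frame_nulls m = nulls left_mult (S m) frames"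

definition words :: "nat \<Rightarrow> nat \<Rightarrow> (nat \<times> 'l) list set" where
  "words N p = inj_words {1..N} L p"

definition bichains :: "nat \<Rightarrow> nat \<Rightarrow> nat \<Rightarrow> ('l letter_map list \<times> (nat \<times> 'l) list \<Rightarrow>\<^sub>0 int) set" where
  "bichains N p q = free_chains (tuples (Suc q) bijections \<times> words N p)"

definition bichain_nulls :: "nat \<Rightarrow> ('l letter_map list \<times> (nat \<times> 'l) list \<Rightarrow>\<^sub>0 int) set" where
  "bichain_nulls N = nulls (\<lambda>s. map_prod (left_mult s) (map s)) (S N) (frames \<times> (\<Union>p. words N p))"

text \<open>
  The double complex has tuples of length \<open>q + 1\<close> and words of length \<open>p\<close> in bidegree \<open>(p, q)\<close>. The vertical
  differential acts on the tuple and the horizontal one on the word. They commute without a sign.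
\<close>
abbreviation dv where "dv \<equiv> on_fst simplex_bd"
abbreviation dh where "dh \<equiv> on_snd list_bd"

lemma frame_nulls_0 [simp]: "0 \<in> frame_nulls m"
    and frame_nulls_diff: "a \<in> frame_nulls m \<Longrightarrow> b \<in> frame_nulls m \<Longrightarrow> a - b \<in> frame_nulls m"
  and frame_nulls_add: "a \<in> frame_nulls m \<Longrightarrow> b \<in> frame_nulls m \<Longrightarrow> a + b \<in> frame_nulls m"
  by (auto simp: frame_nulls_def intro: nulls.diff nulls_add)

lemma bichain_nulls_0 [simp]: "0 \<in> bichain_nulls m"
    and bichain_nulls_diff: "a \<in> bichain_nulls m \<Longrightarrow> b \<in> bichain_nulls m \<Longrightarrow> a - b \<in> bichain_nulls m"
  and bichain_nulls_add: "a \<in> bichain_nulls m \<Longrightarrow> b \<in> bichain_nulls m \<Longrightarrow> a + b \<in> bichain_nulls m"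
  by (auto simp: bichain_nulls_def intro: nulls.diff nulls_add)

lemma S_mono: "m \<le> n \<Longrightarrow> S m \<subseteq> S n"
  by (rule lift_Suc_mono_le[of S, OF S_Suc])

lemma S_bij: "s \<in> S m \<Longrightarrow> bij s"
  using inverse_in[of s m] by (auto intro: o_bij)

lemma bijections_act: "s \<in> S m \<Longrightarrow> e \<in> bijections \<Longrightarrow> s \<circ> e \<in> bijections"
  by (auto simp: bijections_def S_bij bij_comp)

lemma frames_act: "s \<in> S m \<Longrightarrow> es \<in> frames \<Longrightarrow> left_mult s es \<in> frames"
  using bijections_act by (auto simp: frames_def)

lemma tuples_act: "s \<in> S m \<Longrightarrow> es \<in> tuples q bijections \<Longrightarrow> left_mult s es \<in> tuples q bijections"
  using bijections_act by (auto simp: tuples_def)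

lemma words_act:
  assumes s: "s \<in> S N" and w: "w \<in> words N p"
  shows "map s w \<in> words N p"
proof -
  have "inj_on (fst \<circ> s) (set w)"
  proof (rule inj_onI)
    fix l l' assume l: "l \<in> set w" "l' \<in> set w" "(fst \<circ> s) l = (fst \<circ> s) l'"
    moreover have "set w \<subseteq> {1..N} \<times> L" using w by (simp add: words_def inj_words_def)
    ultimately have "fst l = fst l'"
      using colour_inj[OF s, of l l'] by (simp only: comp_apply subset_iff)
    moreover have "inj_on fst (set w)" using w by (simp add: words_def inj_words_def distinct_map)
    ultimately show "l = l'" using l by (simp add: inj_on_def)
  qed
  moreover have "distinct w" using w by (simp add: words_def inj_words_def distinct_map)
  ultimately have "distinct (map fst (map s w))"
    unfolding map_map by (simp only: distinct_map)
  moreover have "set (map s w) \<subseteq> {1..N} \<times> L"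
  proof
    fix l assume "l \<in> set (map s w)"
    then obtain l' where "l' \<in> set w" "l = s l'" by auto
    then show "l \<in> {1..N} \<times> L"
      using w by (auto simp only: words_def inj_words_def mem_Collect_eq intro!: maps_letters[OF s])
  qed
  ultimately show ?thesis using w by (simp add: words_def inj_words_def)
qed

lemma bichains_diff: "a \<in> bichains N p q \<Longrightarrow> b \<in> bichains N p q \<Longrightarrow> a - b \<in> bichains N p q"
  and bichains_0 [simp]: "0 \<in> bichains N p q"
  by (auto simp: bichains_def)

lemma dv_bichains: "z \<in> bichains N p (Suc q) \<Longrightarrow> dv z \<in> bichains N p q"
  unfolding bichains_def on_fst_def
  by (rule frag_extend_chains)
    (auto intro!: frag_extend_chains[OF simplex_bd_tuples])

lemma dv_bichains_0: "z \<in> bichains N p 0 \<Longrightarrow> dv z = 0"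
  unfolding bichains_def on_fst_def
  by (subst frag_extend_chains_cong[of _ _ _ "\<lambda>_. 0"]) (auto simp: tuples_def simplex_bd_def)

lemma dh_bichains: "z \<in> bichains N (Suc p) q \<Longrightarrow> dh z \<in> bichains N p q"
  unfolding bichains_def on_snd_def words_def
  by (rule frag_extend_chains)
    (auto intro!: frag_extend_chains[OF list_bd_inj_words])

lemma dh_bichains_0: "z \<in> bichains N 0 q \<Longrightarrow> dh z = 0"
  unfolding bichains_def on_snd_def words_def inj_words_def
  by (subst frag_extend_chains_cong[of _ _ _ "\<lambda>_. 0"]) auto

lemma dv_dv [simp]: "dv (dv z) = 0" and dh_dh [simp]: "dh (dh z) = 0"
  by (simp_all add: on_fst_on_fst on_snd_on_snd, simp_all add: on_fst_def on_snd_def case_prod_unfold)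

lemma dv_dh: "dv (dh z) = dh (dv z)"
  by (rule on_fst_on_snd)

lemma dv_bichain_nulls:
  assumes "z \<in> bichain_nulls N" shows "dv z \<in> bichain_nulls N"
  using assms unfolding bichain_nulls_def on_fst_def
proof (rule nulls_equivariant)
  fix x assume x: "x \<in> frames \<times> (\<Union>p. words N p)"
  show "(case x of (e, w) \<Rightarrow> push (\<lambda>x. (x, w)) (simplex_bd e)) \<in> free_chains (frames \<times> (\<Union>p. words N p))"
    using x by (auto intro!: frag_extend_chains[OF simplex_bd_frames])
qed (auto simp: simplex_bd_map frag_extend_frag_extend)

lemma dh_bichain_nulls:
  assumes "z \<in> bichain_nulls N" shows "dh z \<in> bichain_nulls N"
  using assms unfolding bichain_nulls_def on_snd_def
proof (rule nulls_equivariant)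
  fix x assume x: "x \<in> frames \<times> (\<Union>p. words N p)"
  then obtain es w p where w: "x = (es, w)" "es \<in> frames" "w \<in> words N p" by auto
  have "list_bd w \<in> free_chains (\<Union>p. words N p)"
  proof (cases p)
    case 0
    then show ?thesis using w by (simp add: words_def inj_words_def)
  next
    case (Suc q)
    then have "list_bd w \<in> free_chains (words N q)" using w by (simp add: words_def list_bd_inj_words)
    then show ?thesis by (rule chains_mono) auto
  qed
  then show "(case x of (e, w) \<Rightarrow> push (Pair e) (list_bd w)) \<in> free_chains (frames \<times> (\<Union>p. words N p))"
    using w by (auto intro!: frag_extend_chains[of "list_bd w"])
qed (auto simp: list_bd_map frag_extend_frag_extend)

text \<open>
  Each orbit of tuples has a chosen representative, and by freeness only one group element takes a given
  tuple there. Moving every pair in this way gives a normal form that kills the null chains and commutes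
  with the horizontal differential. So the coinvariants of a row are a direct sum of copies of the complex
  of words, one for each representative.
\<close>
lemma rows_exact:
  assumes z: "z \<in> bichains N p q" and p: "p < N" and dz: "dh z \<in> bichain_nulls N"
  shows "\<exists>y\<in>bichains N (Suc p) q. z - dh y \<in> bichain_nulls N"
proof -
  define orbit where "orbit es = {left_mult s es |s. s \<in> S N}" for es
  define rep where "rep es = (SOME es'. es' \<in> orbit es)" for es
  define h where "h es = (SOME s. s \<in> S N \<and> left_mult s es = rep es)" for es
  have "es \<in> orbit es" for es
    using id_in[of N] unfolding orbit_def by (auto intro!: exI[of _ id] simp: left_mult_id)
  then have "rep es \<in> orbit es" for es
    unfolding rep_def by (rule someI)
  then have "\<exists>s. s \<in> S N \<and> rep es = left_mult s es" for es
    unfolding orbit_def by auto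
  then have "\<exists>s. s \<in> S N \<and> left_mult s es = rep es" for es
    by metis
  then have h: "h es \<in> S N" "left_mult (h es) es = rep es" for es
    using someI_ex[of "\<lambda>s. s \<in> S N \<and> left_mult s es = rep es"] unfolding h_def by auto
  have rep_act: "rep (left_mult s es) = rep es" if s: "s \<in> S N" for s es
  proof -
    obtain t where t: "t \<in> S N" "t \<circ> s = id" using inverse_in[OF s] by blast
    have "left_mult r es = left_mult (r \<circ> t) (left_mult s es)" for r
      using t(2) by (simp add: o_assoc) (simp add: comp_assoc)
    moreover have "left_mult r (left_mult s es) = left_mult (r \<circ> s) es" for r
      by (simp add: o_assoc)
    ultimately have "orbit (left_mult s es) = orbit es"
      unfolding orbit_def using s t comp_in by (smt (verit) Collect_cong)
    then show ?thesis by (simp add: rep_def)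
  qed
  have h_act: "h (left_mult s es) \<circ> s = h es" if s: "s \<in> S N" and es: "es \<in> frames" for s es
  proof -
    have "left_mult (h (left_mult s es)) (left_mult s es) = left_mult (h es) es"
      using h rep_act[OF s] by metis
    then have "h (left_mult s es) \<circ> s \<circ> hd es = h es \<circ> hd es"
      using es by (cases es) (auto simp: frames_def o_assoc)
    moreover have "bij (hd es)" using es by (cases es) (auto simp: frames_def bijections_def)
    ultimately show ?thesis by (rule comp_bij_cancel[rotated])
  qed
  define nu where "nu = (\<lambda>(es, w). (left_mult (h es) es, map (h es) w))"
  have nu_act: "nu (map_prod (left_mult s) (map s) x) = nu x"
    if "s \<in> S N" "x \<in> frames \<times> (\<Union>p. words N p)" for s x
    using that h_act h rep_act by (auto simp: nu_def)
  have kill: "push nu c = 0" if "c \<in> bichain_nulls N" for c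
  proof -
    have "push nu c \<in> {0}"
      using that unfolding bichain_nulls_def
      by (rule nulls_frag_extend) (simp_all only: nu_act, simp_all)
    then show ?thesis by simp
  qed
  have nu_dh: "push nu (dh c) = dh (push nu c)" for c
    by (induction c rule: frag_induct)
      (auto simp: frag_linear on_snd_diff on_snd_def nu_def frag_extend_frag_extend list_bd_map)
  have "push nu z \<in> bichains N p q"
    using z unfolding bichains_def
        by (rule frag_extend_chains) (auto simp: nu_def intro!: tuples_act words_act h(1))
  moreover have "dh (push nu z) = 0" using kill[OF dz] nu_dh by simp
  ultimately obtain y where y: "y \<in> bichains N (Suc p) q" "dh y = push nu z"
    unfolding bichains_def
    using on_snd_exact[of "tuples (Suc q) bijections"
        "\<lambda>_. words N p" list_bd "\<lambda>_. words N (Suc p)" list_bd]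
      inj_words_acyclic[of "{1..N}" L p] u_in p unfolding words_def by auto
  have "push nu z - z \<in> bichain_nulls N"
    unfolding bichain_nulls_def
  proof (rule push_diff_nulls)
    show "z \<in> free_chains (frames \<times> (\<Union>p. words N p))"
      using z tuples_frames unfolding bichains_def by (elim chains_mono) auto
    show "\<exists>s\<in>S N. nu x = map_prod (left_mult s) (map s) x" for x
      using h(1) by (intro bexI[of _ "h (fst x)"]) (simp_all add: nu_def split: prod.splits)
  qed
  then have "z - dh y \<in> bichain_nulls N"
    using bichain_nulls_diff[OF bichain_nulls_0, of "push nu z - z"] y(2) by simp
  then show ?thesis using y by blast
qed

text \<open>
  The word whose stabiliser in \<open>S (m + p)\<close> is \<open>S m\<close>. Its tail is again such a word, with \<open>m + 1\<close> in place
  of \<open>m\<close>, and so is the word without its last letter.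
\<close>
definition base_word :: "nat \<Rightarrow> nat \<Rightarrow> (nat \<times> 'l) list" where
  "base_word m p = map (\<lambda>i. (i, u)) [Suc m..<Suc (m + p)]"

lemma base_word_0 [simp]: "base_word m 0 = []"
  by (simp add: base_word_def)

lemma base_word_Suc: "base_word m (Suc p) = (Suc m, u) # base_word (Suc m) p"
  by (simp add: base_word_def upt_rec[of "Suc m"])

lemma base_word_Suc_snoc: "base_word m (Suc p) = base_word m p @ [(Suc (m + p), u)]"
  by (simp add: base_word_def)

lemma base_word_inj_words: "base_word m p \<in> inj_words {Suc m..m + p} L p"
  using u_in by (auto simp: base_word_def inj_words_def comp_def)

lemma base_word_in_words: "m + p = N \<Longrightarrow> base_word m p \<in> words N p"
  using base_word_inj_words[of m p] by (auto simp: words_def inj_words_def)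

lemma fixes_word:
  assumes "s \<in> S m" "\<And>l. l \<in> set w \<Longrightarrow> m < fst l"
  shows "map s w = w"
  using assms by (auto intro!: map_idI fixes_outside[OF assms(1)] dest: assms(2))

lemma fixes_base_word: "s \<in> S m \<Longrightarrow> map s (base_word m p) = base_word m p"
  by (rule fixes_word) (auto simp: base_word_def)

lemma stabiliser_base_word:
  "s \<in> S (m + p) \<Longrightarrow> map s (base_word m p) = base_word m p \<Longrightarrow> s \<in> S m"
  by (induction p) (auto simp: base_word_Suc_snoc intro: stabiliser)

text \<open>
  The last letter is moved to its place first; the group one step below then acts on the remaining ones,
  whose colours have become smaller.
\<close>
lemma transitive_base_word:
  "w \<in> words (m + p) p \<Longrightarrow> \<exists>s\<in>S (m + p). map s w = base_word m p"
proof (induction p arbitrary: w)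
  case 0
  then show ?case using id_in by (auto simp: words_def inj_words_def)
next
  case (Suc p)
  then have "w \<noteq> []" by (auto simp: words_def inj_words_def)
  then obtain v l where w: "w = v @ [l]" by (metis append_butlast_last_id)
  have "l \<in> {1..Suc (m + p)} \<times> L"
    using Suc.prems by (auto simp: w words_def inj_words_def)
  then obtain s where s: "s \<in> S (Suc (m + p))" "s l = (Suc (m + p), u)"
    using transitive by blast
  have "map s w \<in> words (Suc (m + p)) (Suc p)"
    using Suc.prems s by (intro words_act) simp_all
  then have sv: "map s v @ [(Suc (m + p), u)] \<in> words (Suc (m + p)) (Suc p)"
    using s(2) by (simp add: w)
  have "l' \<in> {1..m + p} \<times> L" if "l' \<in> set (map s v)" for l'
  proof -
    have "l' \<in> {1..Suc (m + p)} \<times> L" "fst l' \<noteq> Suc (m + p)"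
      using sv that imageI[OF that, of fst]
      by (simp_all only: words_def inj_words_def mem_Collect_eq set_append Un_subset_iff map_append
          distinct_append set_map[symmetric]) auto
    then show ?thesis by (cases l') auto
  qed
  then have "map s v \<in> words (m + p) p"
    using sv by (auto simp: words_def inj_words_def simp del: set_map mem_Sigma_iff)
  then obtain t where t: "t \<in> S (m + p)" "map t (map s v) = base_word m p"
    using Suc.IH by blast
  have "t (Suc (m + p), u) = (Suc (m + p), u)"
    using t by (intro fixes_outside) auto
  then have "map (t \<circ> s) w = base_word m (Suc p)"
    using t s by (simp add: w base_word_Suc_snoc)
  moreover have "t \<circ> s \<in> S (m + Suc p)"
    using t s S_Suc[of "m + p"] by (auto intro: comp_in)
  ultimately show ?case by blast
qed

abbreviation at_word :: "(nat \<times> 'l) list \<Rightarrow> ('l letter_map list \<Rightarrow>\<^sub>0 int) \<Rightarrow> _" where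
  "at_word w \<equiv> push (\<lambda>es. (es, w))"

lemma at_word_bichains: "c \<in> frame_chains q \<Longrightarrow> w \<in> words N p \<Longrightarrow> at_word w c \<in> bichains N p q"
  unfolding frame_chains_def bichains_def by (rule frag_extend_chains) auto

lemma dv_at_word: "dv (at_word w c) = at_word w (bd c)"
  by (rule on_fst_push)

lemma at_word_null:
  assumes "c \<in> frame_nulls m" "m \<le> N" "w \<in> words N p" "\<And>s. s \<in> S m \<Longrightarrow> map s w = w"
  shows "at_word w c \<in> bichain_nulls N"
  using assms(1) unfolding frame_nulls_def bichain_nulls_def
proof (rule nulls_frag_extend_nulls)
  fix s and es :: "'l letter_map list"
  assume "s \<in> S m" "es \<in> frames"
  then show "frag_of (left_mult s es, w) - frag_of (es, w)
      \<in> nulls (\<lambda>s. map_prod (left_mult s) (map s)) (S N) (frames \<times> (\<Union>p. words N p))"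
    using nulls.gen[of s "S N" "(es, w)" "frames \<times> (\<Union>p. words N p)" "\<lambda>s. map_prod (left_mult s) (map s)"]
      assms S_mono[OF assms(2)] by auto
qed

lemma at_base_word_null: "c \<in> frame_nulls m \<Longrightarrow> m + p = N \<Longrightarrow> at_word (base_word m p) c \<in> bichain_nulls N"
  by (rule at_word_null) (auto intro: base_word_in_words fixes_base_word)

text \<open>
  The next two lemmas are Shapiro's lemma at the level of chains: since the words of length \<open>p\<close> form one
  orbit with stabiliser \<open>S m\<close>, sending a tuple to its pair with the base word identifies the coinvariants
  of tuples under \<open>S m\<close> with those of pairs under \<open>S (m + p)\<close>.
\<close>
lemma shapiro_surj:
  assumes y: "y \<in> bichains N p q" and N: "m + p = N"
  shows "\<exists>c\<in>frame_chains q. y - at_word (base_word m p) c \<in> bichain_nulls N"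
proof -
  obtain t where t: "\<And>w. w \<in> words N p \<Longrightarrow> t w \<in> S N \<and> map (t w) w = base_word m p"
    using transitive_base_word[of _ m p] N by metis
  define f where "f = (\<lambda>(es, w). (left_mult (t w) es, base_word m p))"
  define c where "c = push (\<lambda>(es, w). left_mult (t w) es) y"
  have "c \<in> frame_chains q"
    unfolding c_def frame_chains_def using y[unfolded bichains_def]
        by (rule frag_extend_chains) (use t in \<open>auto intro: tuples_act\<close>)
  moreover have "push f y - y
      \<in> nulls (\<lambda>s. map_prod (left_mult s) (map s)) (S N) (tuples (Suc q) bijections \<times> words N p)"
    using y[unfolded bichains_def] by (rule push_diff_nulls) (use t in \<open>force simp: f_def\<close>)
  then have "push f y - y \<in> bichain_nulls N"
    unfolding bichain_nulls_def by (rule nulls_mono) (use tuples_frames in auto)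
  moreover have "push f y = at_word (base_word m p) c"
    unfolding c_def frag_extend_frag_extend f_def by (rule frag_extend_eq) auto
  ultimately show ?thesis using bichain_nulls_diff[OF bichain_nulls_0, of "push f y - y"] by auto
qed

lemma shapiro_inj:
  assumes c: "c \<in> free_chains frames" and N: "m + p = N"
      and null: "at_word (base_word m p) c \<in> bichain_nulls N"
  shows "c \<in> frame_nulls m"
proof -
  obtain t' where t': "\<And>w. w \<in> words N p \<Longrightarrow> t' w \<in> S N \<and> map (t' w) w = base_word m p"
    using transitive_base_word[of _ m p] N by metis
  \<comment> \<open>the identity at the base word makes \<open>f\<close> a left inverse of \<open>at_word (base_word m p)\<close>\<close>
  define t where "t w = (if w = base_word m p then id else t' w)" for w
  have t: "t w \<in> S N" "map (t w) w = base_word m p" if "w \<in> words N p" for w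
    using t'[OF that] id_in by (auto simp: t_def)
  define f where "f = (\<lambda>(es, w). if w \<in> words N p then frag_of (left_mult (t w) es) else 0)"
  have "frag_extend f (at_word (base_word m p) c) \<in> frame_nulls m"
    using null unfolding bichain_nulls_def frame_nulls_def
  proof (rule nulls_frag_extend_nulls)
    fix s and x :: "'l letter_map list \<times> (nat \<times> 'l) list"
    assume s: "s \<in> S N" and x: "x \<in> frames \<times> (\<Union>p. words N p)"
    obtain es w r where xx: "x = (es, w)" "es \<in> frames" "w \<in> words N r" using x by auto
    show "f (map_prod (left_mult s) (map s) x) - f x \<in> nulls left_mult (S m) frames"
    proof (cases "w \<in> words N p")
      case True
      have sw: "map s w \<in> words N p" by (rule words_act[OF s True])
      obtain v where v: "v \<in> S N" "v \<circ> t w = id" "t w \<circ> v = id"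
        using inverse_in t(1)[OF True] by blast
      define k where "k = t (map s w) \<circ> s \<circ> v"
      have "map k (base_word m p) = map (t (map s w)) (map s (map (v \<circ> t w) w))"
        unfolding t(2)[OF True, symmetric] k_def by (simp only: map_map comp_assoc)
      also have "\<dots> = base_word m p" unfolding v(2) using t(2)[OF sw] by simp
      finally have "map k (base_word m p) = base_word m p" .
      moreover have "k \<in> S (m + p)"
        unfolding k_def N by (intro comp_in t(1)[OF sw] s v(1))
      ultimately have "k \<in> S m" by (rule stabiliser_base_word[rotated])
      moreover have "k \<circ> t w = t (map s w) \<circ> s"
        unfolding k_def by (metis v(2) comp_assoc comp_id)
      then have "left_mult k (left_mult (t w) es) = left_mult (t (map s w)) (left_mult s es)"
        by (simp add: o_assoc)
      moreover have "left_mult (t w) es \<in> frames" by (rule frames_act[OF t(1)[OF True] xx(2)])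
      ultimately show ?thesis
        using sw True xx(1) nulls.gen[of k "S m" "left_mult (t w) es" frames left_mult]
        by (simp add: f_def del: map_map)
    next
      case False
      then have "map s w \<notin> words N p"
        using words_act[OF s xx(3)] xx(3) by (auto simp: words_def inj_words_def)
      then show ?thesis using False by (simp add: f_def xx(1))
    qed
  qed
  moreover have "frag_extend f (at_word (base_word m p) c) = c"
    using base_word_in_words[OF N] by (simp add: frag_extend_frag_extend f_def t_def left_mult_id)
  ultimately show ?thesis by simp
qed

text \<open>
  These elements commute with \<open>S m\<close>, because the two groups move disjoint sets of letters.
\<close>
definition upper_stabiliser :: "nat \<Rightarrow> nat \<Rightarrow> 'l letter_map set" where
  "upper_stabiliser N m = {s \<in> S N. \<forall>l. fst l \<le> m \<longrightarrow> s l = l}"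

text \<open>
  All faces of a base word lie in one orbit of \<open>upper_stabiliser N m\<close>. Hence they cancel in pairs, and one
  face is left over if their number \<open>p + 1\<close> is odd. In the induction the cone formula turns the left-over
  face of the tail into a face of the whole word, and one swap of neighbouring colours compares it with
  the tail.
\<close>
lemma list_bd_base_word:
  "m + Suc p \<le> N \<Longrightarrow> list_bd (base_word m (Suc p)) - (if even p then frag_of (base_word (Suc m) p) else 0)
    \<in> nulls map (upper_stabiliser N m) (inj_words {Suc m..N} L p)"
proof (induction p arbitrary: m)
  case 0
  then show ?case by (simp add: base_word_Suc)
next
  case (Suc p)
  let ?x = "(Suc m, u)"
  let ?V = "inj_words {Suc m..N} L (Suc p)"
  let ?b = "list_bd (base_word (Suc m) (Suc p))"
  have "push ((#) ?x) (?b - (if even p then frag_of (base_word (Suc (Suc m)) p) else 0))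
      \<in> nulls map (upper_stabiliser N m) ?V"
  proof (rule nulls_frag_extend_nulls[OF Suc.IH])
    show "Suc m + Suc p \<le> N" using Suc.prems by simp
    fix s w assume s: "s \<in> upper_stabiliser N (Suc m)" and w: "w \<in> inj_words {Suc (Suc m)..N} L p"
    have "?x # w \<in> ?V" using w u_in Suc.prems by (force simp: inj_words_def)
    moreover have "s \<in> upper_stabiliser N m" "s ?x = ?x" using s by (auto simp: upper_stabiliser_def)
    ultimately show "frag_of (?x # map s w) - frag_of (?x # w) \<in> nulls map (upper_stabiliser N m) ?V"
      using nulls.gen[of s "upper_stabiliser N m" "?x # w" ?V map] by simp
  qed
  moreover have "frag_of (base_word (Suc m) (Suc p)) - frag_of (?x # base_word (Suc (Suc m)) p)
      \<in> nulls map (upper_stabiliser N m) ?V"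
  proof -
    obtain s where s: "s \<in> S (Suc (Suc m))" "\<forall>l. fst l \<le> m \<longrightarrow> s l = l" "s ?x = (Suc (Suc m), u)"
      using swap by blast
    have "s \<in> upper_stabiliser N m" using s S_mono[of "Suc (Suc m)" N] Suc.prems
        by (auto simp: upper_stabiliser_def)
    moreover have "?x # base_word (Suc (Suc m)) p \<in> ?V"
      using base_word_inj_words[of "Suc (Suc m)" p] u_in Suc.prems by (force simp: inj_words_def)
    moreover have "map s (?x # base_word (Suc (Suc m)) p) = base_word (Suc m) (Suc p)"
      using s fixes_base_word[OF s(1)] by (simp add: base_word_Suc)
    ultimately show ?thesis using nulls.gen[of s "upper_stabiliser N m"
        "?x # base_word (Suc (Suc m)) p" ?V map] by simp
  qed
  note push_IH = calculation and swapped = this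
  have bd: "list_bd (base_word m (Suc (Suc p))) = frag_of (base_word (Suc m) (Suc p)) - push ((#) ?x) ?b"
    by (simp only: base_word_Suc[of m] list_bd.simps)
  show ?case
  proof (cases "even p")
    case True
    then have "list_bd (base_word m (Suc (Suc p)))
        = (frag_of (base_word (Suc m) (Suc p)) - frag_of (?x # base_word (Suc (Suc m)) p))
        - push ((#) ?x) (?b - (if even p then frag_of (base_word (Suc (Suc m)) p) else 0))"
      by (simp add: bd frag_linear del: list_bd.simps)
    then show ?thesis using nulls.diff[OF swapped push_IH] True by simp
  next
    case False
    then have "list_bd (base_word m (Suc (Suc p))) - frag_of (base_word (Suc m) (Suc p))
        = - push ((#) ?x) (?b - (if even p then frag_of (base_word (Suc (Suc m)) p) else 0))"
      by (simp add: bd del: list_bd.simps)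
    then show ?thesis using nulls_minus[OF push_IH] False by simp
  qed
qed

text \<open>
  The bichains that bound in the coinvariants of their column.
\<close>
definition vertical_boundaries :: "nat \<Rightarrow> nat \<Rightarrow> nat \<Rightarrow> ('l letter_map list \<times> (nat \<times> 'l) list \<Rightarrow>\<^sub>0 int)
    set" where
  "vertical_boundaries N p q = {z. \<exists>b\<in>bichains N p (Suc q). z - dv b \<in> bichain_nulls N}"

lemma vertical_boundaries_diff:
  assumes "a \<in> vertical_boundaries N p q" "b \<in> vertical_boundaries N p q"
      shows "a - b \<in> vertical_boundaries N p q"
proof -
  obtain x y where "x \<in> bichains N p (Suc q)" "a - dv x \<in> bichain_nulls N" "y \<in> bichains N p (Suc q)"
      "b - dv y \<in> bichain_nulls N"
    using assms by (auto simp: vertical_boundaries_def)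
  moreover have "a - b - dv (x - y) = (a - dv x) - (b - dv y)" by (simp add: on_fst_diff)
  ultimately show ?thesis unfolding vertical_boundaries_def using bichains_diff bichain_nulls_diff
      by (metis (mono_tags, lifting) mem_Collect_eq)
qed

lemma bichain_nulls_vertical: "a \<in> bichain_nulls N \<Longrightarrow> a \<in> vertical_boundaries N p q"
  unfolding vertical_boundaries_def by (auto intro!: bexI[of _ 0])

lemma dv_vertical: "b \<in> bichains N p (Suc q) \<Longrightarrow> dv b \<in> vertical_boundaries N p q"
  unfolding vertical_boundaries_def by (auto intro!: bexI[of _ b])

lemma vertical_boundaries_add: assumes "a \<in> vertical_boundaries N p q" "b \<in> vertical_boundaries N p q"
    shows "a + b \<in> vertical_boundaries N p q"
  using vertical_boundaries_diff[OF assms(1) vertical_boundaries_diff[OF bichain_nulls_vertical[OF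
      bichain_nulls_0] assms(2)]] by simp

text \<open>
  An element \<open>s\<close> that commutes with \<open>S m\<close> acts trivially on the homology of \<open>S m\<close>: multiplication by \<open>s\<close> is
  an \<open>S m\<close>-equivariant vertex map, so the prism between it and the identity descends to coinvariants.
  Moving the word by \<open>s\<close> is the same as moving the tuple by its inverse, so it does not change the class.
\<close>
lemma at_word_move:
  assumes c: "c \<in> frame_chains q" "bd c \<in> frame_nulls m" and s: "s \<in> upper_stabiliser N m" and m: "m \<le> N"
    and v: "v \<in> inj_words {Suc m..N} L p"
  shows "at_word (map s v) c - at_word v c \<in> vertical_boundaries N p q"
proof -
  have sN: "s \<in> S N" and fix_s: "\<And>l. fst l \<le> m \<Longrightarrow> s l = l" using s by (auto simp: upper_stabiliser_def)
  have above: "m < fst (s l)" if "m < fst l" for l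
  proof (rule ccontr)
    assume "\<not> m < fst (s l)"
    then have "s (s l) = s l" by (intro fix_s) simp
    then have "s l = l" using S_bij[OF sN] by (metis bij_pointE)
    then show False using that \<open>\<not> m < fst (s l)\<close> by simp
  qed
  have vN: "v \<in> words N p" using v by (force simp: words_def inj_words_def)
  have svN: "map s v \<in> words N p" by (rule words_act[OF sN vN])
  have fix_sv: "map t (map s v) = map s v" if "t \<in> S m" for t
    using that
  proof (rule fixes_word)
    fix l assume "l \<in> set (map s v)"
    then obtain l' where "l' \<in> set v" "l = s l'" by auto
    moreover from this have "m < fst l'" using v by (auto simp: inj_words_def)
    ultimately show "m < fst l" using above by simp
  qed
  have comm: "s \<circ> t = t \<circ> s" if t: "t \<in> S m" for t
  proof
    fix l :: "nat \<times> 'l"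
    have below: "fst (t l) \<le> m" if "fst l \<le> m"
    proof (rule ccontr)
      assume "\<not> fst (t l) \<le> m"
      then have "t (t l) = t l" by (intro fixes_outside[OF t]) auto
      then have "t l = l" using S_bij[OF t] by (metis bij_pointE)
      then show False using that \<open>\<not> fst (t l) \<le> m\<close> by simp
    qed
    show "(s \<circ> t) l = (t \<circ> s) l"
    proof (cases "fst l \<le> m")
      case True
      then show ?thesis using below fix_s by simp
    next
      case False
      then have "t l = l" "t (s l) = s l" using above[of l] by (auto intro!: fixes_outside[OF t])
      then show ?thesis by simp
    qed
  qed
  let ?P = "frag_extend (prism (\<lambda>e. e) ((\<circ>) s))"
  have prism_frames: "prism (\<lambda>e. e) ((\<circ>) s) es \<in> free_chains (tuples (Suc (length es)) bijections)"
      if "es \<in> frames" for es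
    using that by (intro prism_chains) (auto simp: frames_def bijections_act[OF sN])
  have P_D: "?P x \<in> frame_nulls m" if "x \<in> frame_nulls m" for x
    using that unfolding frame_nulls_def
  proof (rule nulls_equivariant)
    fix es :: "'l letter_map list"
    assume "es \<in> frames"
    then show "prism (\<lambda>e. e) ((\<circ>) s) es \<in> free_chains frames"
      using prism_frames tuples_frames chains_mono by blast
  next
    fix t and es :: "'l letter_map list"
    assume "t \<in> S m"
    then show "prism (\<lambda>e. e) ((\<circ>) s) (left_mult t es) = push (left_mult t) (prism (\<lambda>e. e) ((\<circ>) s) es)"
      using comm by (intro prism_equivariant) (simp_all add: o_assoc)
  qed
  have Pc: "?P c \<in> frame_chains (Suc q)"
    using c(1) unfolding frame_chains_def
  proof (rule frag_extend_chains)
    fix es :: "'l letter_map list"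
    assume "es \<in> tuples (Suc q) bijections"
    then show "prism (\<lambda>e. e) ((\<circ>) s) es \<in> free_chains (tuples (Suc (Suc q)) bijections)"
      using prism_frames[of es] tuples_frames[of q] by (auto simp: tuples_def)
  qed
  have "push (left_mult s) c - c = bd (?P c) + ?P (bd c)"
    using bd_prism[of "(\<circ>) s" c "\<lambda>e. e"] by simp
  then have "at_word (map s v) (push (left_mult s) c) - at_word (map s v) c
      = dv (at_word (map s v) (?P c)) + at_word (map s v) (?P (bd c))"
    unfolding dv_at_word by (metis frag_extend_diff frag_extend_add)
  moreover have "dv (at_word (map s v) (?P c)) \<in> vertical_boundaries N p q"
    by (intro dv_vertical at_word_bichains Pc svN)
  moreover have "at_word (map s v) (?P (bd c)) \<in> vertical_boundaries N p q"
    by (intro bichain_nulls_vertical at_word_null[OF P_D[OF c(2)] m svN fix_sv])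
  moreover have "at_word (map s v) (push (left_mult s) c) - at_word v c \<in> vertical_boundaries N p q"
  proof (rule bichain_nulls_vertical)
    have "at_word v c \<in> free_chains (frames \<times> (\<Union>p. words N p))"
      using frame_chains_frames[OF c(1)] by (rule frag_extend_chains) (use vN in auto)
    then show "at_word (map s v) (push (left_mult s) c) - at_word v c \<in> bichain_nulls N"
      unfolding bichain_nulls_def
          using push_nulls[OF _ sN, of "at_word v c" _ "\<lambda>s. map_prod (left_mult s) (map s)"]
      by (simp add: frag_extend_frag_extend)
  qed
  ultimately have "at_word (map s v) (push (left_mult s) c) - at_word v c
      - (at_word (map s v) (push (left_mult s) c) - at_word (map s v) c) \<in> vertical_boundaries N p q"
    using vertical_boundaries_diff vertical_boundaries_add by metis
  then show ?thesis by simp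
qed

lemma dh_at_base_word:
  assumes c: "c \<in> frame_chains q" "bd c \<in> frame_nulls m" and N: "m + Suc p = N"
  shows "dh (at_word (base_word m (Suc p)) c)
      - (if even p then at_word (base_word (Suc m) p) c else 0) \<in> vertical_boundaries N p q"
proof -
  have "frag_extend (\<lambda>v. at_word v c) (list_bd (base_word m (Suc p))
      - (if even p then frag_of (base_word (Suc m) p) else 0)) \<in> vertical_boundaries N p q"
    by (rule nulls_frag_extend[OF list_bd_base_word])
      (use N vertical_boundaries_diff in \<open>auto intro: at_word_move[OF c] bichain_nulls_vertical\<close>)
  moreover have "frag_extend (\<lambda>v. at_word v c) (if even p then frag_of (base_word (Suc m) p) else 0)
      = (if even p then at_word (base_word (Suc m) p) c else 0)"
    by simp
  ultimately show ?thesis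
    unfolding on_snd_push_fst frag_extend_diff by simp
qed

text \<open>
  Injectivity and surjectivity of the map from the homology of \<open>S m\<close> to that of \<open>S (Suc m)\<close> in degree \<open>q\<close>,
  spelled out for chains.
\<close>
definition stab_injective :: "nat \<Rightarrow> nat \<Rightarrow> bool" where
  "stab_injective m q \<longleftrightarrow> (\<forall>c\<in>frame_chains q. bd c \<in> frame_nulls m
      \<longrightarrow> (\<exists>b\<in>frame_chains (Suc q). c - bd b \<in> frame_nulls (Suc m))
     \<longrightarrow> (\<exists>b\<in>frame_chains (Suc q). c - bd b \<in> frame_nulls m))"

definition stab_surjective :: "nat \<Rightarrow> nat \<Rightarrow> bool" where
  "stab_surjective m q \<longleftrightarrow> (\<forall>c\<in>frame_chains q. bd c \<in> frame_nulls (Suc m) \<longrightarrow>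
     (\<exists>c'\<in>frame_chains q. bd c' \<in> frame_nulls m
         \<and> (\<exists>b\<in>frame_chains (Suc q). c - c' - bd b \<in> frame_nulls (Suc m))))"

lemma shapiro_cycle:
  assumes y: "y \<in> bichains N p q" "dv y \<in> bichain_nulls N" and N: "m + p = N"
  shows "\<exists>c\<in>frame_chains q. y - at_word (base_word m p) c \<in> bichain_nulls N \<and> bd c \<in> frame_nulls m"
proof -
  obtain c where c: "c \<in> frame_chains q" "y - at_word (base_word m p) c \<in> bichain_nulls N"
      using shapiro_surj[OF y(1) N] by blast
  have "at_word (base_word m p) (bd c) = dv y - dv (y - at_word (base_word m p) c)"
    by (simp add: on_fst_diff dv_at_word)
  then have "at_word (base_word m p) (bd c) \<in> bichain_nulls N"
      using y(2) dv_bichain_nulls[OF c(2)] bichain_nulls_diff by metis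
  then have "bd c \<in> frame_nulls m" using shapiro_inj[OF bd_frames[OF frame_chains_frames[OF c(1)]] N]
      by simp
  then show ?thesis using c by blast
qed

lemma shapiro_boundary:
  assumes c: "c \<in> frame_chains q" and N: "m + p = N"
      and "at_word (base_word m p) c \<in> vertical_boundaries N p q"
  shows "\<exists>b\<in>frame_chains (Suc q). c - bd b \<in> frame_nulls m"
proof -
  obtain b where b: "b \<in> bichains N p (Suc q)" "at_word (base_word m p) c - dv b \<in> bichain_nulls N"
    using assms(3) by (auto simp: vertical_boundaries_def)
  obtain b' where b': "b' \<in> frame_chains (Suc q)" "b - at_word (base_word m p) b' \<in> bichain_nulls N"
    using shapiro_surj[OF b(1) N] by blast
  have "at_word (base_word m p) (c - bd b')
      = (at_word (base_word m p) c - dv b) + dv (b - at_word (base_word m p) b')"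
    by (simp add: on_fst_diff dv_at_word frag_linear)
  then have "at_word (base_word m p) (c - bd b') \<in> bichain_nulls N"
    using b(2) dv_bichain_nulls[OF b'(2)] bichain_nulls_add by metis
  moreover have "c - bd b' \<in> free_chains frames"
    by (intro chains_diff frame_chains_frames[OF c] bd_frames frame_chains_frames[OF b'(1)])
  ultimately show ?thesis using shapiro_inj[OF _ N] b'(1) by blast
qed

text \<open>
  The class of \<open>y\<close> in the homology of column \<open>p + 1\<close> is sent to zero in column \<open>p\<close>. If that map is
  stabilisation, injectivity shows that the class itself is zero. If it is zero, then the map into column
  \<open>p + 1\<close> is stabilisation, and surjectivity shows that the class comes from column \<open>p + 2\<close>.
\<close>
lemma second_page_vanishes:
  assumes y: "y \<in> bichains N (Suc p) q" "dv y \<in> bichain_nulls N"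
      and x: "x \<in> bichains N p (Suc q)" "dh y - dv x \<in> bichain_nulls N"
    and N: "Suc m + Suc p = N" and range: "stab_injective (Suc m) q" "stab_surjective m q"
  shows "\<exists>t\<in>bichains N (Suc (Suc p)) q. dv t \<in> bichain_nulls N
      \<and> y - dh t \<in> vertical_boundaries N (Suc p) q"
proof -
  let ?w = "base_word (Suc m) (Suc p)"
  obtain c where c: "c \<in> frame_chains q" "y - at_word ?w c \<in> bichain_nulls N"
      "bd c \<in> frame_nulls (Suc m)"
    using shapiro_cycle[OF y N] by blast
  show ?thesis
  proof (cases "even p")
    case True
    have "at_word (base_word (Suc (Suc m)) p) c = (dh y - dv x) + dv x - dh (y - at_word ?w c)
        - (dh (at_word ?w c) - at_word (base_word (Suc (Suc m)) p) c)"
      by (simp add: on_snd_diff)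
    moreover have "dh (at_word ?w c) - at_word (base_word (Suc (Suc m)) p) c \<in> vertical_boundaries N p q"
      using dh_at_base_word[OF c(1,3) N] True by simp
    ultimately have "at_word (base_word (Suc (Suc m)) p) c \<in> vertical_boundaries N p q"
      using bichain_nulls_vertical[OF x(2), of p q] dv_vertical[OF x(1)] bichain_nulls_vertical[OF
          dh_bichain_nulls[OF c(2)], of p q] vertical_boundaries_diff vertical_boundaries_add by metis
    then have "\<exists>b\<in>frame_chains (Suc q). c - bd b \<in> frame_nulls (Suc (Suc m))"
      using N by (intro shapiro_boundary[OF c(1)]) auto
    then obtain b where b: "b \<in> frame_chains (Suc q)" "c - bd b \<in> frame_nulls (Suc m)"
      using range(1) c unfolding stab_injective_def by blast
    have "y = (y - at_word ?w c) + at_word ?w (c - bd b) + dv (at_word ?w b)"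
      by (simp add: dv_at_word frag_linear)
    moreover have "at_word ?w (c - bd b) \<in> bichain_nulls N" by (rule at_base_word_null[OF b(2) N])
    moreover have "at_word ?w b \<in> bichains N (Suc p) (Suc q)"
        by (intro at_word_bichains b base_word_in_words N)
    ultimately have "y \<in> vertical_boundaries N (Suc p) q"
      using bichain_nulls_vertical[OF c(2), of "Suc p" q] bichain_nulls_vertical dv_vertical
          vertical_boundaries_add by metis
    then show ?thesis by (intro bexI[of _ 0]) auto
  next
    case False
    let ?w' = "base_word m (Suc (Suc p))"
    obtain c' b where c': "c' \<in> frame_chains q" "bd c' \<in> frame_nulls m"
        and b: "b \<in> frame_chains (Suc q)" "c - c' - bd b \<in> frame_nulls (Suc m)"
      using range(2) c unfolding stab_surjective_def by blast
    have N': "m + Suc (Suc p) = N" using N by simp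
    have "at_word ?w' c' \<in> bichains N (Suc (Suc p)) q"
        by (intro at_word_bichains c' base_word_in_words N')
    moreover have "dv (at_word ?w' c') \<in> bichain_nulls N" unfolding dv_at_word
        by (rule at_base_word_null[OF c'(2) N'])
    moreover have "y - dh (at_word ?w' c') \<in> vertical_boundaries N (Suc p) q"
    proof -
      have "y - dh (at_word ?w' c') = (y - at_word ?w c) + at_word ?w (c - c' - bd b) + dv (at_word ?w b)
          - (dh (at_word ?w' c') - at_word ?w c')"
        by (simp add: dv_at_word frag_linear)
      moreover have "dh (at_word ?w' c') - at_word ?w c' \<in> vertical_boundaries N (Suc p) q"
        using dh_at_base_word[OF c' N'] False by simp
      moreover have "at_word ?w (c - c' - bd b) \<in> bichain_nulls N" by (rule at_base_word_null[OF b(2) N])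
      moreover have "at_word ?w b \<in> bichains N (Suc p) (Suc q)"
          by (intro at_word_bichains b base_word_in_words N)
      ultimately show ?thesis
        using bichain_nulls_vertical[OF c(2), of "Suc p" q] bichain_nulls_vertical dv_vertical
            vertical_boundaries_add vertical_boundaries_diff by metis
    qed
    ultimately show ?thesis by blast
  qed
qed

text \<open>
  Exactness of the rows yields a horizontal preimage of \<open>z\<close>, which may fail to be a vertical cycle. Its
  vertical boundary is a vertical and horizontal cycle in lower degree, hence lifts to a vertical cycle
  \<open>y\<close> by induction. By the previous lemma \<open>y\<close> differs from a vertical boundary \<open>dv w\<close> by a horizontal boundary, and
  then \<open>dh w\<close> is the correction that makes the preimage a vertical cycle.
\<close>
lemma lift_cycle:
  assumes "\<And>q' m. q' < q \<Longrightarrow> 2 * q' + 1 \<le> m \<Longrightarrow> stab_injective m q'"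
    and "\<And>q' m. q' < q \<Longrightarrow> 2 * q' \<le> m \<Longrightarrow> stab_surjective m q'"
    and "p + 2 * q + 1 \<le> N" "z \<in> bichains N p q" "dv z \<in> bichain_nulls N" "dh z \<in> bichain_nulls N"
  shows "\<exists>x\<in>bichains N (Suc p) q. dv x \<in> bichain_nulls N \<and> z - dh x \<in> bichain_nulls N"
  using assms
proof (induction q arbitrary: p z)
  case 0
  then show ?case using rows_exact[of z N p 0] dv_bichains_0
      by (metis bichain_nulls_0 add_leD1 Suc_eq_plus1 Suc_le_eq mult_0_right add.right_neutral)
next
  case (Suc r)
  obtain x where x: "x \<in> bichains N (Suc p) (Suc r)" "z - dh x \<in> bichain_nulls N"
    using rows_exact[of z N p "Suc r"] Suc.prems by auto
  have "dh (dv x) = dv z - dv (z - dh x)"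
    by (simp add: on_fst_diff dv_dh)
  then have "dh (dv x) \<in> bichain_nulls N"
      using Suc.prems(5) dv_bichain_nulls[OF x(2)] bichain_nulls_diff by metis
  then obtain y where y: "y \<in> bichains N (Suc (Suc p)) r" "dv y \<in> bichain_nulls N"
      "dv x - dh y \<in> bichain_nulls N"
    using Suc.IH[of "Suc p" "dv x"] Suc.prems dv_bichains[OF x(1)] by auto
  have yx: "dh y - dv x \<in> bichain_nulls N" using bichain_nulls_diff[OF bichain_nulls_0 y(3)] by simp
  \<comment> \<open>\<open>y\<close> lies in column \<open>p + 2\<close>, which computes the homology of \<open>S (N - p - 2)\<close>\<close>
  define m where "m = N - p - 3"
  have m: "Suc m + Suc (Suc p) = N" "2 * r \<le> m" using Suc.prems(3) by (auto simp: m_def)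
  then have "stab_injective (Suc m) r" "stab_surjective m r"
    using Suc.prems(1,2) by auto
  then obtain t where t: "t \<in> bichains N (Suc (Suc (Suc p))) r" "dv t \<in> bichain_nulls N"
      "y - dh t \<in> vertical_boundaries N (Suc (Suc p)) r"
    using second_page_vanishes[OF y(1,2) x(1) yx m(1)] by blast
  then obtain w where w: "w \<in> bichains N (Suc (Suc p)) (Suc r)" "y - dh t - dv w \<in> bichain_nulls N"
    by (auto simp: vertical_boundaries_def)
  have "dv (x - dh w) = (dv x - dh y) + dh (y - dh t - dv w)"
    by (simp add: on_fst_diff on_snd_diff dv_dh)
  then have "dv (x - dh w) \<in> bichain_nulls N" using y(3) dh_bichain_nulls[OF w(2)] bichain_nulls_add
      by metis
  moreover have "z - dh (x - dh w) \<in> bichain_nulls N" using x(2) by (simp add: on_snd_diff)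
  moreover have "x - dh w \<in> bichains N (Suc p) (Suc r)" by (intro bichains_diff x dh_bichains w)
  ultimately show ?case by blast
qed

text \<open>
  In column 0 a class of \<open>S (n + 1)\<close> lifts to column 1, which computes the homology of \<open>S n\<close>; this is
  surjectivity. If a class in column 1 is sent to zero, it lifts to column 2, and the map out of column 2
  vanishes in homology, so the class was zero; this is injectivity. Both lifts need \<open>N \<ge> p + 2 q + 1\<close> for
  \<open>N = n + 1\<close>, which is where the two ranges differ by one.
\<close>
lemma stability:
  "(2 * q + 1 \<le> n \<longrightarrow> stab_injective n q) \<and> (2 * q \<le> n \<longrightarrow> stab_surjective n q)"
proof (induction q arbitrary: n rule: less_induct)
  case (less q)
  then have IH: "\<And>q' m. q' < q \<Longrightarrow> 2 * q' + 1 \<le> m \<Longrightarrow> stab_injective m q'"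
    "\<And>q' m. q' < q \<Longrightarrow> 2 * q' \<le> m \<Longrightarrow> stab_surjective m q'" by auto
  define N where "N = Suc n"
  have N: "N + 0 = N" "n + Suc 0 = N" by (simp_all add: N_def)
  have dh1: "dh (at_word (base_word n (Suc 0)) c) = at_word [] c" for c
    unfolding on_snd_push_fst by (simp add: base_word_Suc)
  show ?case
  proof (intro conjI impI)
    assume n: "2 * q \<le> n"
    show "stab_surjective n q" unfolding stab_surjective_def
    proof (intro ballI impI)
      fix c assume c: "c \<in> frame_chains q" "bd c \<in> frame_nulls (Suc n)"
      have z: "at_word [] c \<in> bichains N 0 q"
          using at_word_bichains[OF c(1) base_word_in_words[OF N(1)]] by simp
      have "dv (at_word [] c) \<in> bichain_nulls N"
        using at_base_word_null[OF c(2), of 0 N] by (simp add: dv_at_word N_def)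
      then obtain x where x: "x \<in> bichains N (Suc 0) q" "dv x \<in> bichain_nulls N"
          "at_word [] c - dh x \<in> bichain_nulls N"
        using lift_cycle[OF IH _ z] n dh_bichains_0[OF z] by (auto simp: N_def)
      obtain c' where c': "c' \<in> frame_chains q"
          "x - at_word (base_word n (Suc 0)) c' \<in> bichain_nulls N" "bd c' \<in> frame_nulls n"
        using shapiro_cycle[OF x(1,2) N(2)] by blast
      have "at_word [] (c - c') = (at_word [] c - dh x) + dh (x - at_word (base_word n (Suc 0)) c')"
        by (simp add: on_snd_diff dh1 frag_linear)
      then have "at_word [] (c - c') \<in> bichain_nulls N"
          using x(3) dh_bichain_nulls[OF c'(2)] bichain_nulls_add by metis
      then have "c - c' \<in> frame_nulls (Suc n)"
        using shapiro_inj[of "c - c'" N 0 N] frame_chains_frames[OF frame_chains_diff[OF c(1) c'(1)]]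
            by (simp add: N_def)
      then show "\<exists>c'\<in>frame_chains q. bd c' \<in> frame_nulls n
          \<and> (\<exists>b\<in>frame_chains (Suc q). c - c' - bd b \<in> frame_nulls (Suc n))"
        using c' by (intro bexI[of _ c'] conjI bexI[of _ 0]) auto
    qed
  next
    assume n: "2 * q + 1 \<le> n"
    then obtain m where m: "n = Suc m" by (cases n) auto
    show "stab_injective n q" unfolding stab_injective_def
    proof (intro ballI impI)
      fix c assume c: "c \<in> frame_chains q" "bd c \<in> frame_nulls n"
          and "\<exists>b\<in>frame_chains (Suc q). c - bd b \<in> frame_nulls (Suc n)"
      then obtain b where b: "b \<in> frame_chains (Suc q)" "c - bd b \<in> frame_nulls (Suc n)" by blast
      \<comment> \<open>subtracting the boundary makes the image in column 0 null and not just a boundary\<close>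
      let ?z = "at_word (base_word n (Suc 0)) (c - bd b)"
      have z: "?z \<in> bichains N (Suc 0) q"
          by (intro at_word_bichains frame_chains_diff c bd_frame_chains b base_word_in_words N)
      have "dv ?z \<in> bichain_nulls N"
        unfolding dv_at_word using at_base_word_null[OF c(2) N(2)] by (simp add: frag_linear)
      moreover have "dh ?z \<in> bichain_nulls N"
        using at_base_word_null[OF b(2), of 0 N] by (simp add: dh1 N_def)
      ultimately obtain x where x: "x \<in> bichains N (Suc (Suc 0)) q" "dv x \<in> bichain_nulls N"
          "?z - dh x \<in> bichain_nulls N"
        using lift_cycle[OF IH _ z] n by (auto simp: N_def)
      have N2: "m + Suc (Suc 0) = N" by (simp add: N_def m)
      obtain y where y: "y \<in> frame_chains q"
          "x - at_word (base_word m (Suc (Suc 0))) y \<in> bichain_nulls N" "bd y \<in> frame_nulls m"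
        using shapiro_cycle[OF x(1,2) N2] by blast
      have "dh (at_word (base_word m (Suc (Suc 0))) y) \<in> vertical_boundaries N (Suc 0) q"
        using dh_at_base_word[OF y(1,3) N2] by simp
      moreover have "?z = (?z - dh x) + dh (x - at_word (base_word m (Suc (Suc 0))) y)
          + dh (at_word (base_word m (Suc (Suc 0))) y)"
        by (simp add: on_snd_diff)
      ultimately have "?z \<in> vertical_boundaries N (Suc 0) q"
        using bichain_nulls_vertical[OF x(3), of "Suc 0" q] bichain_nulls_vertical[OF
            dh_bichain_nulls[OF y(2)], of "Suc 0" q] vertical_boundaries_add by metis
      then obtain e where e: "e \<in> frame_chains (Suc q)" "c - bd b - bd e \<in> frame_nulls n"
        using shapiro_boundary[OF frame_chains_diff[OF c(1) bd_frame_chains[OF b(1)]] N(2)] by blast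
      then show "\<exists>b\<in>frame_chains (Suc q). c - bd b \<in> frame_nulls n"
        using b(1) by (intro bexI[of _ "b + e"]) (auto simp: frag_linear frame_chains_add algebra_simps)
    qed
  qed
qed

end

section \<open>Comparison with the bar complex\<close>

lemma list_bd_sum:
  "list_bd xs = (\<Sum>j<length xs. frag_cmul ((-1) ^ j) (frag_of (take j xs @ drop (Suc j) xs)))"
proof (induction xs)
  case (Cons x xs)
  have "list_bd (x # xs) = frag_of xs
      - (\<Sum>j<length xs. frag_cmul ((-1) ^ j) (frag_of (x # take j xs @ drop (Suc j) xs)))"
    unfolding list_bd.simps Cons by (simp add: frag_extend_sum frag_extend_cmul o_def)
  also have "\<dots> = (\<Sum>j<Suc (length xs). frag_cmul ((-1) ^ j) (frag_of (take j (x # xs) @ drop (Suc j) (x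
      # xs))))"
    by (subst sum.lessThan_Suc_shift) (simp add: sum_negf[symmetric])
  finally show ?case by simp
qed simp

text \<open>
  The passage from homogeneous coordinates \<open>(x\<^sub>0, \<dots>, x\<^sub>k)\<close> to the bar symbol
  \<open>[x\<^sub>0\<inverse> x\<^sub>1 | \<dots> | x\<^sub>k\<^sub>-\<^sub>1\<inverse> x\<^sub>k]\<close>, and back for a given first entry.
\<close>
definition quotients :: "('g, 'b) monoid_scheme \<Rightarrow> 'g list \<Rightarrow> 'g list" where
  "quotients \<Gamma> xs = map (\<lambda>i. inv\<^bsub>\<Gamma>\<^esub> (xs ! i) \<otimes>\<^bsub>\<Gamma>\<^esub> xs ! Suc i) [0..<length xs - 1]"

primrec partial_products :: "('g, 'b) monoid_scheme \<Rightarrow> 'g \<Rightarrow> 'g list \<Rightarrow> 'g list" where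
  "partial_products \<Gamma> x [] = [x]"
| "partial_products \<Gamma> x (g # gs) = x # partial_products \<Gamma> (x \<otimes>\<^bsub>\<Gamma>\<^esub> g) gs"

lemma length_quotients [simp]: "length (quotients \<Gamma> xs) = length xs - 1"
  by (simp add: quotients_def)

lemma quotients_Cons:
  "quotients \<Gamma> (x # y # zs) = (inv\<^bsub>\<Gamma>\<^esub> x \<otimes>\<^bsub>\<Gamma>\<^esub> y) # quotients \<Gamma> (y # zs)"
  by (simp add: quotients_def map_upt_Suc del: upt_Suc)

lemma quotients_single [simp]: "quotients \<Gamma> [x] = []"
  by (simp add: quotients_def)

lemma length_partial_products [simp]: "length (partial_products \<Gamma> x gs) = Suc (length gs)"
  by (induction gs arbitrary: x) auto

context group
begin

lemma inv_cancel_left: "x \<in> carrier G \<Longrightarrow> y \<in> carrier G \<Longrightarrow> inv x \<otimes> (x \<otimes> y) = y"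
  and cancel_inv_left: "x \<in> carrier G \<Longrightarrow> y \<in> carrier G \<Longrightarrow> x \<otimes> (inv x \<otimes> y) = y"
  by (simp_all flip: m_assoc)

lemma quotients_closed: "set xs \<subseteq> carrier G \<Longrightarrow> set (quotients G xs) \<subseteq> carrier G"
  by (auto simp: quotients_def subset_iff)

lemma partial_products_closed:
  "x \<in> carrier G \<Longrightarrow> set gs \<subseteq> carrier G \<Longrightarrow> set (partial_products G x gs) \<subseteq> carrier G"
  by (induction gs arbitrary: x) auto

lemma quotients_partial_products:
  "x \<in> carrier G \<Longrightarrow> set gs \<subseteq> carrier G \<Longrightarrow> quotients G (partial_products G x gs) = gs"
proof (induction gs arbitrary: x)
  case (Cons g gs)
  obtain ys where ys: "partial_products G (x \<otimes> g) gs = (x \<otimes> g) # ys"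
    by (cases gs) auto
  have "quotients G (partial_products G (x \<otimes> g) gs) = gs" using Cons by auto
  moreover have "inv x \<otimes> (x \<otimes> g) = g" using Cons.prems by (simp flip: m_assoc)
  ultimately show ?case using ys by (simp add: quotients_Cons)
qed simp

lemma partial_products_quotients:
  "set (x # xs) \<subseteq> carrier G \<Longrightarrow> partial_products G x (quotients G (x # xs)) = x # xs"
proof (induction xs arbitrary: x)
  case (Cons y xs)
  then have "x \<otimes> (inv x \<otimes> y) = y" by (simp flip: m_assoc)
  then show ?case using Cons by (simp add: quotients_Cons)
qed simp

lemma partial_products_left:
  "x \<in> carrier G \<Longrightarrow> y \<in> carrier G \<Longrightarrow> set gs \<subseteq> carrier G \<Longrightarrow>
    partial_products G (y \<otimes> x) gs = map ((\<otimes>) y) (partial_products G x gs)"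
  by (induction gs arbitrary: x) (auto simp: m_assoc)

lemma quotients_left:
  assumes "y \<in> carrier G" "set xs \<subseteq> carrier G"
  shows "quotients G (map ((\<otimes>) y) xs) = quotients G xs"
  unfolding quotients_def
proof (rule map_cong)
  fix i assume "i \<in> set [0..<length xs - 1]"
  then have i: "i < length xs" "Suc i < length xs" by auto
  then have "xs ! i \<in> carrier G" "xs ! Suc i \<in> carrier G" using assms(2) nth_mem by blast+
  then have "inv (y \<otimes> xs ! i) \<otimes> (y \<otimes> xs ! Suc i) = inv (xs ! i) \<otimes> xs ! Suc i"
    using assms(1) by (simp add: inv_mult_group m_assoc inv_cancel_left)
  then show "inv (map ((\<otimes>) y) xs ! i) \<otimes> map ((\<otimes>) y) xs ! Suc i = inv (xs ! i) \<otimes> xs ! Suc i"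
    using i by simp
qed simp

text \<open>
  Deleting an inner entry multiplies the two adjacent quotients; deleting an outer entry drops one.
\<close>
lemma quotients_delete:
  assumes xs: "set xs \<subseteq> carrier G" and j: "j < length xs"
  shows "quotients G (take j xs @ drop (Suc j) xs) = bar_face G j (quotients G xs)"
proof (rule nth_equalityI)
  show len: "length (quotients G (take j xs @ drop (Suc j) xs)) = length (bar_face G j (quotients G xs))"
    using j by (simp add: length_bar_face)
  fix p assume "p < length (quotients G (take j xs @ drop (Suc j) xs))"
  then have p: "p + 2 < length xs" using j by simp
  have del: "(take j xs @ drop (Suc j) xs) ! i = (if i < j then xs ! i else xs ! Suc i)"
    if "Suc i < length xs" for i
    using that j by (auto simp: nth_append min_def)
  have c: "xs ! p \<in> carrier G" "xs ! Suc p \<in> carrier G" "xs ! Suc (Suc p) \<in> carrier G"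
    using xs p by (auto intro!: subsetD[OF xs])
  have merge: "inv (xs ! p) \<otimes> xs ! Suc p \<otimes> (inv (xs ! Suc p) \<otimes> xs ! Suc (Suc p))
      = inv (xs ! p) \<otimes> xs ! Suc (Suc p)"
    using c by (simp add: m_assoc cancel_inv_left)
  show "quotients G (take j xs @ drop (Suc j) xs) ! p = bar_face G j (quotients G xs) ! p"
    using p j merge by (subst nth_bar_face) (auto simp: quotients_def del)
qed

lemma bar_boundary_quotients:
  assumes "set xs \<subseteq> carrier G" "xs \<noteq> []"
  shows "bar_boundary G (frag_of (quotients G xs)) = push (quotients G) (simplex_bd xs)"
proof (cases "length xs \<le> 1")
  case True
  then have "quotients G xs = []" by (simp add: quotients_def)
  then show ?thesis using True by (simp add: bar_boundary_def simplex_bd_def)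
next
  case False
  then have ne: "quotients G xs \<noteq> []" by (simp flip: length_0_conv)
  have "{..length (quotients G xs)} = {..<length xs}" using False by auto
  then have "bar_boundary G (frag_of (quotients G xs))
      = (\<Sum>j<length xs. frag_cmul ((-1) ^ j) (frag_of (bar_face G j (quotients G xs))))"
    using ne by (simp add: bar_boundary_of)
  also have "\<dots> = (\<Sum>j<length xs. frag_cmul ((-1) ^ j) (frag_of (quotients G (take j xs @ drop (Suc j)
      xs))))"
    by (intro sum.cong) (auto simp: quotients_delete[OF assms(1)])
  also have "\<dots> = push (quotients G) (simplex_bd xs)"
    using False by (simp add: simplex_bd_def list_bd_sum frag_extend_sum frag_extend_cmul o_def)
  finally show ?thesis .
qed

end

lemma list_in_image:
  "set ys \<subseteq> f ` A \<Longrightarrow> \<exists>xs. ys = map f xs \<and> set xs \<subseteq> A"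
proof (induction ys)
  case (Cons y ys)
  then obtain x xs where "y = f x" "x \<in> A" "ys = map f xs" "set xs \<subseteq> A" by auto
  then show ?case by (intro exI[of _ "x # xs"]) simp
qed simp

text \<open>
  A faithful action of a group by bijections. Its homology in terms of tuples of bijections is compared
  with its bar complex.
\<close>
locale bijective_rep = group \<Gamma> for \<Gamma> (structure) +
  fixes J :: "'a \<Rightarrow> 'x \<Rightarrow> 'x"
  assumes J_mult: "x \<in> carrier \<Gamma> \<Longrightarrow> y \<in> carrier \<Gamma> \<Longrightarrow> J (x \<otimes> y) = J x \<circ> J y"
    and J_bij: "x \<in> carrier \<Gamma> \<Longrightarrow> bij (J x)"
    and J_inj: "inj_on J (carrier \<Gamma>)"
begin

abbreviation rep_nulls :: "(('x \<Rightarrow> 'x) list \<Rightarrow>\<^sub>0 int) set" where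
  "rep_nulls \<equiv> nulls left_mult (J ` carrier \<Gamma>) frames"

lemma J_one: "J \<one> = id"
  using comp_bij_cancel[of "J \<one>" "J \<one>" id] J_mult[of \<one> \<one>] J_bij by simp

lemma J_inv: "g \<in> carrier \<Gamma> \<Longrightarrow> J (inv g) \<circ> J g = id"
  using J_mult[of "inv g" g] J_one by simp

text \<open>
  The orbits of bijections are torsors, so choosing a base point in each of them gives an equivariant map
  to the group. The identity as base point of its own orbit makes this map a retraction.
\<close>
lemma equivariant_retraction:
  "\<exists>\<rho>. (\<forall>e\<in>bijections. \<rho> e \<in> carrier \<Gamma>) \<and> (\<forall>g\<in>carrier \<Gamma>. \<forall>e\<in>bijections. \<rho> (J g \<circ> e) = g \<otimes> \<rho> e)
    \<and> (\<forall>g\<in>carrier \<Gamma>. \<rho> (J g) = g)"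
proof -
  define orbit where "orbit (e :: 'x \<Rightarrow> 'x) = {J g \<circ> e |g. g \<in> carrier \<Gamma>}" for e
  define rep where "rep e = (if id \<in> orbit e then id else SOME e'. e' \<in> orbit e)" for e
  have self: "e \<in> orbit e" for e
    using one_closed unfolding orbit_def by (auto intro!: exI[of _ \<one>] simp: J_one)
  have "(SOME e'. e' \<in> orbit e) \<in> orbit e" for e
    using someI[of "\<lambda>e'. e' \<in> orbit e", OF self] .
  then have rep: "rep e \<in> orbit e" for e
    by (simp add: rep_def)
  have "\<exists>g\<in>carrier \<Gamma>. e = J g \<circ> rep e" for e
  proof -
    obtain g where g: "g \<in> carrier \<Gamma>" "rep e = J g \<circ> e" using rep[of e] by (auto simp: orbit_def)
    then have "J (inv g) \<circ> rep e = e" using J_inv by (simp add: o_assoc)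
    then show ?thesis using g by (intro bexI[of _ "inv g"]) auto
  qed
  then obtain \<rho> where \<rho>: "\<And>e. \<rho> e \<in> carrier \<Gamma>" "\<And>e. e = J (\<rho> e) \<circ> rep e" by metis
  have orbit_act: "orbit (J g \<circ> e) = orbit e" if g: "g \<in> carrier \<Gamma>" for g e
  proof
    show "orbit (J g \<circ> e) \<subseteq> orbit e"
      using g by (auto simp: orbit_def o_assoc simp flip: J_mult)
    show "orbit e \<subseteq> orbit (J g \<circ> e)"
    proof
      fix f assume "f \<in> orbit e"
      then obtain h where h: "h \<in> carrier \<Gamma>" "f = J h \<circ> e" by (auto simp: orbit_def)
      have "J (h \<otimes> inv g) \<circ> (J g \<circ> e) = J h \<circ> (J (inv g) \<circ> J g) \<circ> e"
        using g h(1) by (simp only: J_mult inv_closed comp_assoc)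
      then have "f = J (h \<otimes> inv g) \<circ> (J g \<circ> e)"
        using J_inv[OF g] h(2) by simp
      then show "f \<in> orbit (J g \<circ> e)" using g h by (auto simp: orbit_def)
    qed
  qed
  have rep_act: "rep (J g \<circ> e) = rep e" if "g \<in> carrier \<Gamma>" for g e
    using orbit_act[OF that] by (simp add: rep_def)
  have unique: "g = \<rho> e" if "g \<in> carrier \<Gamma>" "e \<in> bijections" "e = J g \<circ> rep e" for g e
  proof -
    have "bij (rep e)"
    proof -
      obtain h where "h \<in> carrier \<Gamma>" "rep e = J h \<circ> e" using rep[of e] by (auto simp: orbit_def)
      then show ?thesis using that(2) J_bij by (auto simp: bijections_def bij_comp)
    qed
    moreover have "J g \<circ> rep e = J (\<rho> e) \<circ> rep e" using \<rho>(2)[of e] that(3) by simp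
    ultimately have "J g = J (\<rho> e)" by (rule comp_bij_cancel)
    then show ?thesis using J_inj \<rho>(1) that(1) by (auto dest: inj_onD)
  qed
  have "\<rho> (J g \<circ> e) = g \<otimes> \<rho> e" if g: "g \<in> carrier \<Gamma>" and e: "e \<in> bijections" for g e
  proof (rule unique[symmetric])
    show "J g \<circ> e \<in> bijections" using e g J_bij by (auto simp: bijections_def bij_comp)
    show "J g \<circ> e = J (g \<otimes> \<rho> e) \<circ> rep (J g \<circ> e)"
      using \<rho> g by (metis rep_act J_mult comp_assoc)
  qed (use g \<rho> in auto)
  moreover have "\<rho> (J g) = g" if g: "g \<in> carrier \<Gamma>" for g
  proof (rule unique[symmetric])
    have "id \<in> orbit (J g)"
      unfolding orbit_def using g J_inv[OF g] by (intro CollectI exI[of _ "inv g"]) simp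
    then show "J g = J g \<circ> rep (J g)" by (simp add: rep_def)
  qed (use g J_bij in \<open>auto simp: bijections_def\<close>)
  ultimately show ?thesis using \<rho>(1) by blast
qed

definition \<rho> :: "('x \<Rightarrow> 'x) \<Rightarrow> 'a" where
  "\<rho> = (SOME \<rho>. (\<forall>e\<in>bijections. \<rho> e \<in> carrier \<Gamma>) \<and> (\<forall>g\<in>carrier \<Gamma>. \<forall>e\<in>bijections. \<rho> (J g \<circ> e) = g \<otimes> \<rho> e)
    \<and> (\<forall>g\<in>carrier \<Gamma>. \<rho> (J g) = g))"

lemma \<rho>_closed: "e \<in> bijections \<Longrightarrow> \<rho> e \<in> carrier \<Gamma>"
  and \<rho>_act: "g \<in> carrier \<Gamma> \<Longrightarrow> e \<in> bijections \<Longrightarrow> \<rho> (J g \<circ> e) = g \<otimes> \<rho> e"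
  and \<rho>_J: "g \<in> carrier \<Gamma> \<Longrightarrow> \<rho> (J g) = g"
  using someI_ex[OF equivariant_retraction] unfolding \<rho>_def[symmetric] by blast+

lemma J_bijections: "g \<in> carrier \<Gamma> \<Longrightarrow> J g \<in> bijections"
  by (simp add: bijections_def J_bij)

definition to_bar :: "(('x \<Rightarrow> 'x) list \<Rightarrow>\<^sub>0 int) \<Rightarrow> ('a list \<Rightarrow>\<^sub>0 int)" where
  "to_bar = push (\<lambda>es. quotients \<Gamma> (map \<rho> es))"

definition of_bar :: "('a list \<Rightarrow>\<^sub>0 int) \<Rightarrow> (('x \<Rightarrow> 'x) list \<Rightarrow>\<^sub>0 int)" where
  "of_bar = push (\<lambda>gs. map J (partial_products \<Gamma> \<one> gs))"

lemma map_\<rho>_closed: "set es \<subseteq> bijections \<Longrightarrow> set (map \<rho> es) \<subseteq> carrier \<Gamma>"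
  using \<rho>_closed by auto

lemma to_bar_closed: "c \<in> frame_chains q \<Longrightarrow> to_bar c \<in> free_chains (tuples q (carrier \<Gamma>))"
  unfolding to_bar_def frame_chains_def
  by (rule frag_extend_chains) (auto simp: tuples_def dest: quotients_closed[OF map_\<rho>_closed, THEN
      subsetD])

lemma of_bar_group_frames:
  assumes "b \<in> free_chains (tuples q (carrier \<Gamma>))"
  shows "of_bar b \<in> free_chains (tuples (Suc q) (J ` carrier \<Gamma>))"
  using assms unfolding of_bar_def
proof (rule frag_extend_chains)
  fix gs assume gs: "gs \<in> tuples q (carrier \<Gamma>)"
  then have "set (partial_products \<Gamma> \<one> gs) \<subseteq> carrier \<Gamma>"
    by (intro partial_products_closed) (auto simp: tuples_def)
  then show "frag_of (map J (partial_products \<Gamma> \<one> gs)) \<in> free_chains (tuples (Suc q) (J ` carrier \<Gamma>))"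
    using gs by (simp add: tuples_def image_mono)
qed

lemma of_bar_closed: "b \<in> free_chains (tuples q (carrier \<Gamma>)) \<Longrightarrow> of_bar b \<in> frame_chains q"
  unfolding frame_chains_def
      by (drule of_bar_group_frames, erule chains_mono) (auto simp: tuples_def J_bijections)

lemma bar_boundary_to_bar:
  assumes "c \<in> free_chains frames"
  shows "bar_boundary \<Gamma> (to_bar c) = to_bar (bd c)"
  using assms
proof (induction rule: chains_induct)
  case (one es)
  then have "bar_boundary \<Gamma> (to_bar (frag_of es)) = push (quotients \<Gamma>) (simplex_bd (map \<rho> es))"
    unfolding to_bar_def frag_extend_of
    by (intro bar_boundary_quotients map_\<rho>_closed) (auto simp: frames_def)
  then show ?case by (simp add: to_bar_def simplex_bd_map frag_extend_frag_extend)
qed (simp_all add: to_bar_def frag_linear bar_boundary_def)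

lemma to_bar_null:
  assumes "c \<in> rep_nulls" shows "to_bar c = 0"
proof -
  have "to_bar c \<in> {0}"
    using assms unfolding to_bar_def
  proof (rule nulls_frag_extend)
    fix s and es :: "('x \<Rightarrow> 'x) list"
    assume "s \<in> J ` carrier \<Gamma>" "es \<in> frames"
    then obtain g where g: "g \<in> carrier \<Gamma>" "s = J g" "set es \<subseteq> bijections" by (auto simp: frames_def)
    then have "map \<rho> (left_mult s es) = map ((\<otimes>) g) (map \<rho> es)"
      using \<rho>_act by auto
    then have "quotients \<Gamma> (map \<rho> (left_mult s es)) = quotients \<Gamma> (map \<rho> es)"
      by (simp only: quotients_left[OF g(1) map_\<rho>_closed[OF g(3)]])
    then show "frag_of (quotients \<Gamma> (map \<rho> (left_mult s es))) - frag_of (quotients \<Gamma> (map \<rho> es)) \<in> {0}"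
      by simp
  qed auto
  then show ?thesis by simp
qed

lemma map_\<rho>_J: "set gs \<subseteq> carrier \<Gamma> \<Longrightarrow> map \<rho> (map J gs) = gs"
  using \<rho>_J by (auto intro!: map_idI simp: subset_iff)

lemma to_bar_of_bar:
  assumes "b \<in> free_chains (tuples q (carrier \<Gamma>))"
  shows "to_bar (of_bar b) = b"
proof -
  have "to_bar (of_bar b) = frag_extend frag_of b"
    unfolding to_bar_def of_bar_def frag_extend_frag_extend frag_extend_of
    using assms
  proof (rule frag_extend_chains_cong)
    fix gs assume "gs \<in> tuples q (carrier \<Gamma>)"
    then have "set gs \<subseteq> carrier \<Gamma>" by (simp add: tuples_def)
    then show "frag_of (quotients \<Gamma> (map \<rho> (map J (partial_products \<Gamma> \<one> gs)))) = frag_of gs"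
      using map_\<rho>_J[OF partial_products_closed[OF one_closed]] quotients_partial_products[OF one_closed]
      by simp
  qed
  then show ?thesis by simp
qed

text \<open>
  A tuple of group elements differs from the tuple that is rebuilt from its bar symbol only by its first
  entry, that is, by a left translation.
\<close>
lemma group_frames_normalise:
  assumes "x \<in> free_chains {es. es \<noteq> [] \<and> set es \<subseteq> J ` carrier \<Gamma>}"
  shows "of_bar (to_bar x) - x \<in> rep_nulls"
proof -
  have "push (\<lambda>es. map J (partial_products \<Gamma> \<one> (quotients \<Gamma> (map \<rho> es)))) x - x
      \<in> nulls left_mult (J ` carrier \<Gamma>) {es. es \<noteq> [] \<and> set es \<subseteq> J ` carrier \<Gamma>}"
    using assms
  proof (rule push_diff_nulls)
    fix es assume "es \<in> {es. es \<noteq> [] \<and> set es \<subseteq> J ` carrier \<Gamma>}"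
    then obtain g gs where es: "es = map J (g # gs)" "set (g # gs) \<subseteq> carrier \<Gamma>"
      using list_in_image[of es J "carrier \<Gamma>"] by (auto simp: neq_Nil_conv)
    let ?q = "quotients \<Gamma> (g # gs)"
    have q: "set ?q \<subseteq> carrier \<Gamma>" by (rule quotients_closed[OF es(2)])
    have "partial_products \<Gamma> \<one> ?q = partial_products \<Gamma> (inv g \<otimes> g) ?q"
      using es(2) by simp
    also have "\<dots> = map ((\<otimes>) (inv g)) (partial_products \<Gamma> g ?q)"
      using es(2) q by (intro partial_products_left) auto
    also have "\<dots> = map ((\<otimes>) (inv g)) (g # gs)"
      by (simp only: partial_products_quotients[OF es(2)])
    finally have "map J (partial_products \<Gamma> \<one> ?q) = left_mult (J (inv g)) es"
      using es J_mult J_inv J_one by (auto simp: subset_iff)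
    moreover have "map \<rho> es = g # gs"
      unfolding es(1) by (rule map_\<rho>_J[OF es(2)])
    ultimately show "\<exists>s\<in>J ` carrier \<Gamma>. map J (partial_products \<Gamma> \<one> (quotients \<Gamma> (map \<rho> es)))
        = left_mult s es"
      using es(2) by auto
  qed
  then have "of_bar (to_bar x) - x \<in> nulls left_mult (J ` carrier \<Gamma>) {es. es \<noteq> []
      \<and> set es \<subseteq> J ` carrier \<Gamma>}"
    by (simp add: of_bar_def to_bar_def frag_extend_frag_extend)
  then show ?thesis by (rule nulls_mono) (auto simp: frames_def J_bijections)
qed

text \<open>
  That \<open>of_bar\<close> is a chain map modulo null chains needs no computation with faces: both chains consist of
  tuples of group elements and have the same bar chain.
\<close>
lemma bd_of_bar:
  assumes b: "b \<in> free_chains (tuples q (carrier \<Gamma>))"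
  shows "of_bar (bar_boundary \<Gamma> b) - bd (of_bar b) \<in> rep_nulls"
proof -
  have "bd (of_bar b) \<in> free_chains {es. es \<noteq> [] \<and> set es \<subseteq> J ` carrier \<Gamma>}"
  proof (cases q)
    case 0
    have "bd (of_bar b) = frag_extend (\<lambda>_. 0) (of_bar b)"
      by (rule frag_extend_chains_cong[OF of_bar_group_frames[OF b]]) (simp add: 0 tuples_def
          simplex_bd_def)
    then show ?thesis by simp
  next
    case (Suc k)
    have "bd (of_bar b) \<in> free_chains (tuples q (J ` carrier \<Gamma>))"
      by (rule bd_chains[OF of_bar_group_frames[OF b]])
    then show ?thesis by (rule chains_mono) (auto simp: tuples_def Suc)
  qed
  then have "of_bar (to_bar (bd (of_bar b))) - bd (of_bar b) \<in> rep_nulls"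
    by (rule group_frames_normalise)
  moreover have "to_bar (bd (of_bar b)) = bar_boundary \<Gamma> b"
    using bar_boundary_to_bar[OF frame_chains_frames[OF of_bar_closed[OF b]]] to_bar_of_bar[OF b] by simp
  ultimately show ?thesis by simp
qed

text \<open>
  Composing both maps retracts all bijections to the group. The prism between this vertex map and the
  identity is equivariant, which gives the homology.
\<close>
lemma of_bar_to_bar:
  assumes c: "c \<in> frame_chains q" "bd c \<in> rep_nulls"
  shows "\<exists>b\<in>frame_chains (Suc q). c - of_bar (to_bar c) - bd b \<in> rep_nulls"
proof -
  define \<phi> where "\<phi> e = J (\<rho> e)" for e
  have \<phi>_E: "\<phi> e \<in> bijections" if "e \<in> bijections" for e
    using that by (simp add: \<phi>_def J_bijections \<rho>_closed)
  let ?P = "frag_extend (prism (\<lambda>e. e) \<phi>)"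
  have prism_frames: "prism (\<lambda>e. e) \<phi> es \<in> free_chains (tuples (Suc (length es)) bijections)"
      if "es \<in> frames" for es
    using that by (intro prism_chains) (auto simp: frames_def \<phi>_E)
  have P_nul: "?P x \<in> rep_nulls" if "x \<in> rep_nulls" for x
    using that
  proof (rule nulls_equivariant)
    fix es :: "('x \<Rightarrow> 'x) list" assume "es \<in> frames"
    then show "prism (\<lambda>e. e) \<phi> es \<in> free_chains frames"
      using prism_frames tuples_frames chains_mono by blast
  next
    fix t and es :: "('x \<Rightarrow> 'x) list" assume "t \<in> J ` carrier \<Gamma>" "es \<in> frames"
    then show "prism (\<lambda>e. e) \<phi> (left_mult t es) = push (left_mult t) (prism (\<lambda>e. e) \<phi> es)"
      by (intro prism_equivariant) (auto simp: frames_def \<phi>_def \<rho>_act \<rho>_closed J_mult subset_iff)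
  qed
  have Pc: "?P c \<in> frame_chains (Suc q)"
    using c(1) unfolding frame_chains_def
  proof (rule frag_extend_chains)
    fix es :: "('x \<Rightarrow> 'x) list" assume "es \<in> tuples (Suc q) bijections"
    then show "prism (\<lambda>e. e) \<phi> es \<in> free_chains (tuples (Suc (Suc q)) bijections)"
      using prism_frames[of es] tuples_frames[of q] by (auto simp: tuples_def)
  qed
  define x where "x = push (map \<phi>) c"
  have x_c: "x - c = bd (?P c) + ?P (bd c)"
    using bd_prism[of \<phi> c "\<lambda>e. e"] by (simp add: x_def)
  have "x \<in> free_chains {es. es \<noteq> [] \<and> set es \<subseteq> J ` carrier \<Gamma>}"
    unfolding x_def using frame_chains_frames[OF c(1)]
    by (rule frag_extend_chains) (auto simp: frames_def \<phi>_def intro!: \<rho>_closed)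
  then have "of_bar (to_bar x) - x \<in> rep_nulls" by (rule group_frames_normalise)
  moreover have "to_bar x = to_bar c"
    unfolding to_bar_def x_def frag_extend_frag_extend
    using frame_chains_frames[OF c(1)]
  proof (rule frag_extend_chains_cong)
    fix es :: "('x \<Rightarrow> 'x) list" assume "es \<in> frames"
    then have "map \<rho> (map \<phi> es) = map \<rho> es"
      by (auto simp: frames_def \<phi>_def \<rho>_J \<rho>_closed subset_iff)
    then show "frag_extend (\<lambda>es. frag_of (quotients \<Gamma> (map \<rho> es))) (frag_of (map \<phi> es))
        = frag_of (quotients \<Gamma> (map \<rho> es))"
      by (simp only: frag_extend_of)
  qed
  ultimately have "of_bar (to_bar c) - x + ?P (bd c) \<in> rep_nulls"
    using P_nul[OF c(2)] by (auto intro: nulls_add)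
  then have "- (of_bar (to_bar c) - x + ?P (bd c)) \<in> rep_nulls" by (rule nulls_minus)
  moreover have "- (of_bar (to_bar c) - x + ?P (bd c)) = c - of_bar (to_bar c) - bd (- ?P c)"
    using x_c by (simp add: frag_linear algebra_simps)
  moreover have "- ?P c \<in> frame_chains (Suc q)" using Pc by (auto simp: frame_chains_def)
  ultimately show ?thesis by metis
qed

end

section \<open>Maps on group homology in terms of cycles\<close>

definition bar_class :: "('a, 'b) monoid_scheme \<Rightarrow> nat \<Rightarrow> ('a list \<Rightarrow>\<^sub>0 int) \<Rightarrow> ('a list \<Rightarrow>\<^sub>0 int) set" where
  "bar_class G k z = (\<lambda>b. b + z) ` bar_boundaries G k"

lemma r_coset_bar_boundaries:
  "bar_boundaries G k #>\<^bsub>bar_cycle_group G k\<^esub> z = bar_class G k z"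
  by (auto simp: r_coset_def bar_class_def bar_cycle_group_def bar_chain_group_def)

lemma bar_boundary_0 [simp]: "bar_boundary G 0 = 0"
  and bar_boundary_diff: "bar_boundary G (a - b) = bar_boundary G a - bar_boundary G b"
  and bar_boundary_add: "bar_boundary G (a + b) = bar_boundary G a + bar_boundary G b"
  by (simp_all add: bar_boundary_def frag_linear)

lemma carrier_bar_chain_group: "carrier (bar_chain_group G k) = free_chains (tuples k (carrier G))"
  unfolding bar_chain_group_def free_chains_def tuples_def by (simp only: free_Abelian_group_def) simp

lemma bar_boundaries_iff:
  "x \<in> bar_boundaries G k \<longleftrightarrow> (\<exists>b\<in>free_chains (tuples (Suc k) (carrier G)). x = bar_boundary G b)"
  by (auto simp: bar_boundaries_def carrier_bar_chain_group)

lemma bar_boundaries_0 [simp]: "0 \<in> bar_boundaries G k"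
  unfolding bar_boundaries_iff by (auto intro!: bexI[of _ 0])

lemma bar_boundaries_diff:
  "x \<in> bar_boundaries G k \<Longrightarrow> y \<in> bar_boundaries G k \<Longrightarrow> x - y \<in> bar_boundaries G k"
  unfolding bar_boundaries_iff by (metis bar_boundary_diff chains_diff)

lemma bar_boundaries_add:
  "x \<in> bar_boundaries G k \<Longrightarrow> y \<in> bar_boundaries G k \<Longrightarrow> x + y \<in> bar_boundaries G k"
  unfolding bar_boundaries_iff by (metis bar_boundary_add chains_add)

definition bar_cycles :: "('a, 'b) monoid_scheme \<Rightarrow> nat \<Rightarrow> ('a list \<Rightarrow>\<^sub>0 int) set" where
  "bar_cycles G k = {z \<in> free_chains (tuples k (carrier G)). bar_boundary G z = 0}"

lemma bar_class_eq_iff: "bar_class G k z = bar_class G k z' \<longleftrightarrow> z - z' \<in> bar_boundaries G k"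
proof
  assume "bar_class G k z = bar_class G k z'"
  moreover have "0 + z \<in> bar_class G k z" unfolding bar_class_def by (rule imageI) simp
  ultimately obtain b where "b \<in> bar_boundaries G k" "z = b + z'" by (auto simp: bar_class_def)
  then show "z - z' \<in> bar_boundaries G k" by simp
next
  assume d: "z - z' \<in> bar_boundaries G k"
  have "b + z \<in> bar_class G k z'" if "b \<in> bar_boundaries G k" for b
    unfolding bar_class_def using bar_boundaries_add[OF that d]
    by (intro image_eqI[of _ _ "b + (z - z')"]) auto
  moreover have "b + z' \<in> bar_class G k z" if "b \<in> bar_boundaries G k" for b
    unfolding bar_class_def using bar_boundaries_diff[OF that d]
    by (intro image_eqI[of _ _ "b - (z - z')"]) auto
  ultimately show "bar_class G k z = bar_class G k z'" by (auto simp: bar_class_def)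
qed

lemma bar_class_add:
  "bar_class G k z <#>\<^bsub>bar_cycle_group G k\<^esub> bar_class G k z' = bar_class G k (z + z')"
proof -
  have "bar_class G k z <#>\<^bsub>bar_cycle_group G k\<^esub> bar_class G k z'
      = {b + z + (b' + z') |b b'. b \<in> bar_boundaries G k \<and> b' \<in> bar_boundaries G k}"
    by (auto simp: set_mult_def bar_class_def bar_cycle_group_def bar_chain_group_def)
  also have "\<dots> = bar_class G k (z + z')"
  proof (intro equalityI subsetI)
    fix x assume "x \<in> {b + z + (b' + z') |b b'. b \<in> bar_boundaries G k \<and> b' \<in> bar_boundaries G k}"
    then obtain b b' where b: "b \<in> bar_boundaries G k" "b' \<in> bar_boundaries G k" "x = b + z + (b' + z')"
      by blast
    have "x = (b + b') + (z + z')" unfolding b(3) by (simp only: ac_simps)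
    then show "x \<in> bar_class G k (z + z')"
      unfolding bar_class_def using bar_boundaries_add[OF b(1,2)] by blast
  next
    fix x assume "x \<in> bar_class G k (z + z')"
    then obtain b where b: "b \<in> bar_boundaries G k" "x = b + (z + z')" by (auto simp: bar_class_def)
    have "x = b + z + (0 + z')" by (simp only: b(2) add.left_neutral add.assoc)
    then show "x \<in> {b + z + (b' + z') |b b'. b \<in> bar_boundaries G k \<and> b' \<in> bar_boundaries G k}"
      using b(1) bar_boundaries_0 by blast
  qed
  finally show ?thesis .
qed

lemma carrier_group_homology: "carrier (group_homology k G) = bar_class G k ` bar_cycles G k"
proof -
  have "carrier (bar_cycle_group G k) = bar_cycles G k"
    by (simp add: bar_cycle_group_def bar_cycles_def carrier_bar_chain_group)
  then show ?thesis
    by (auto simp: group_homology_def FactGroup_def RCOSETS_def r_coset_bar_boundaries)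
qed

lemma mult_group_homology:
  "bar_class G k z \<otimes>\<^bsub>group_homology k G\<^esub> bar_class G k z' = bar_class G k (z + z')"
  by (simp add: group_homology_def FactGroup_def bar_class_add)

context
  fixes G :: "('a, 'b) monoid_scheme" and H :: "('c, 'd) monoid_scheme" and f :: "'a \<Rightarrow> 'c"
  assumes f: "f \<in> hom G H"
begin

lemma bar_cycles_map: "z \<in> bar_cycles G k \<Longrightarrow> bar_chain_map f z \<in> bar_cycles H k"
  using bar_chain_map_closed[OF f] bar_chain_map_boundary[OF f]
  by (auto simp: bar_cycles_def bar_chain_map_def simp flip: carrier_bar_chain_group)

lemma bar_boundaries_map:
  assumes "z \<in> bar_boundaries G k"
  shows "bar_chain_map f z \<in> bar_boundaries H k"
proof -
  obtain b where b: "b \<in> carrier (bar_chain_group G (Suc k))" "z = bar_boundary G b"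
    using assms by (auto simp: bar_boundaries_def)
  then have "bar_chain_map f z = bar_boundary H (bar_chain_map f b)"
    using bar_chain_map_boundary[OF f] by simp
  then show ?thesis
    unfolding bar_boundaries_def using bar_chain_map_closed[OF f b(1)] by simp
qed

lemma group_homology_map_class:
  "group_homology_map k H f (bar_class G k z) = bar_class H k (bar_chain_map f z)"
proof -
  have "(\<lambda>z. bar_class H k (bar_chain_map f z)) ` bar_class G k z = {bar_class H k (bar_chain_map f z)}"
  proof -
    have "bar_class H k (bar_chain_map f (b + z)) = bar_class H k (bar_chain_map f z)"
      if "b \<in> bar_boundaries G k" for b
      unfolding bar_class_eq_iff using bar_boundaries_map[OF that]
      by (simp add: bar_chain_map_def frag_linear)
    moreover have "bar_boundaries G k \<noteq> {}" using bar_boundaries_0 by blast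
    ultimately show ?thesis
      unfolding bar_class_def[of G] image_image by (auto simp: image_constant_conv)
  qed
  then show ?thesis
    unfolding group_homology_map_def r_coset_bar_boundaries by simp
qed

lemma group_homology_map_hom:
  "group_homology_map k H f \<in> hom (group_homology k G) (group_homology k H)"
proof (rule homI)
  fix x y assume "x \<in> carrier (group_homology k G)" "y \<in> carrier (group_homology k G)"
  then obtain z z' where "x = bar_class G k z" "y = bar_class G k z'"
    by (auto simp: carrier_group_homology)
  then show "group_homology_map k H f (x \<otimes>\<^bsub>group_homology k G\<^esub> y)
      = group_homology_map k H f x \<otimes>\<^bsub>group_homology k H\<^esub> group_homology_map k H f y"
    by (simp add: mult_group_homology group_homology_map_class bar_chain_map_def frag_linear)
qed (auto simp: carrier_group_homology group_homology_map_class bar_cycles_map)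

lemma group_homology_map_epiI:
  assumes "\<And>w. w \<in> bar_cycles H k \<Longrightarrow> \<exists>z\<in>bar_cycles G k. w - bar_chain_map f z \<in> bar_boundaries H k"
  shows "group_homology_map k H f \<in> epi (group_homology k G) (group_homology k H)"
  unfolding epi_iff_subset
proof (intro conjI group_homology_map_hom subsetI)
  fix x assume "x \<in> carrier (group_homology k H)"
  then obtain w where w: "w \<in> bar_cycles H k" "x = bar_class H k w"
      by (auto simp: carrier_group_homology)
  then obtain z where "z \<in> bar_cycles G k" "w - bar_chain_map f z \<in> bar_boundaries H k"
    using assms by blast
  then show "x \<in> group_homology_map k H f ` carrier (group_homology k G)"
    unfolding carrier_group_homology
    by (intro image_eqI[of _ _ "bar_class G k z"])
      (auto simp: w(2) group_homology_map_class bar_class_eq_iff)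
qed

lemma group_homology_map_monI:
  assumes "\<And>z. z \<in> bar_cycles G k \<Longrightarrow> bar_chain_map f z \<in> bar_boundaries H k \<Longrightarrow> z \<in> bar_boundaries G k"
  shows "group_homology_map k H f \<in> mon (group_homology k G) (group_homology k H)"
  unfolding mon_def
proof (intro CollectI conjI group_homology_map_hom inj_onI)
  fix x y assume xy: "x \<in> carrier (group_homology k G)" "y \<in> carrier (group_homology k G)"
    "group_homology_map k H f x = group_homology_map k H f y"
  then obtain z z' where z: "z \<in> bar_cycles G k" "z' \<in> bar_cycles G k"
    "x = bar_class G k z" "y = bar_class G k z'"
    by (auto simp: carrier_group_homology)
  have "bar_chain_map f (z - z') \<in> bar_boundaries H k"
    using xy(3) by (simp add: z group_homology_map_class bar_class_eq_iff bar_chain_map_def frag_linear)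
  moreover have "z - z' \<in> bar_cycles G k"
    using z by (auto simp: bar_cycles_def bar_boundary_diff)
  ultimately show "x = y" using assms by (simp add: z bar_class_eq_iff)
qed

end

section \<open>The wreath product acting on letters\<close>

text \<open>
  The wreath product as the group of automorphisms of the free right \<open>G\<close>-set on \<open>m\<close> generators. Pairs
  outside \<open>{1..m} \<times> carrier G\<close> are fixed, which makes the actions for different \<open>m\<close> compatible
  (\<open>letter_action_incl\<close>) and bijective on the whole type.
\<close>
definition letter_action ::
  "('a, 'b) monoid_scheme \<Rightarrow> nat \<Rightarrow> (nat \<Rightarrow> 'a) \<times> (nat \<Rightarrow> nat) \<Rightarrow> nat \<times> 'a \<Rightarrow> nat \<times> 'a" where
  "letter_action G m = (\<lambda>(g, \<sigma>) (i, a).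
     if i \<in> {1..m} \<and> a \<in> carrier G then (\<sigma> i, g (\<sigma> i) \<otimes>\<^bsub>G\<^esub> a) else (i, a))"

lemma carrier_wreath_sym:
  "(g, \<sigma>) \<in> carrier (wreath_sym G m) \<longleftrightarrow> g \<in> {1..m} \<rightarrow>\<^sub>E carrier G \<and> \<sigma> permutes {1..m}"
  by (auto simp: wreath_sym_def sym_group_def)

context group
begin

lemma letter_action_mult:
  assumes "x \<in> carrier (wreath_sym G m)" "y \<in> carrier (wreath_sym G m)"
  shows "letter_action G m (x \<otimes>\<^bsub>wreath_sym G m\<^esub> y) = letter_action G m x \<circ> letter_action G m y"
proof
  fix l :: "nat \<times> 'a"
  obtain g \<sigma> h \<tau> i a where e: "x = (g, \<sigma>)" "y = (h, \<tau>)" "l = (i, a)" by (metis surj_pair)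
  have x: "g \<in> {1..m} \<rightarrow>\<^sub>E carrier G" "\<sigma> permutes {1..m}"
    and y: "h \<in> {1..m} \<rightarrow>\<^sub>E carrier G" "\<tau> permutes {1..m}"
    using assms by (simp_all only: e carrier_wreath_sym)
  show "letter_action G m (x \<otimes>\<^bsub>wreath_sym G m\<^esub> y) l = (letter_action G m x \<circ> letter_action G m y) l"
  proof (cases "i \<in> {1..m} \<and> a \<in> carrier G")
    case True
    then have i: "\<tau> i \<in> {1..m}" "\<sigma> (\<tau> i) \<in> {1..m}"
      using permutes_in_image[OF x(2)] permutes_in_image[OF y(2)] by blast+
    then have c: "h (\<tau> i) \<in> carrier G" "g (\<sigma> (\<tau> i)) \<in> carrier G"
      using x(1) y(1) by (meson PiE_mem)+
    have "inv_into UNIV \<sigma> (\<sigma> (\<tau> i)) = \<tau> i" using permutes_inverses(2)[OF x(2)] by simp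
    then show ?thesis
      using True i c by (simp add: letter_action_def e wreath_sym_def sym_group_def m_assoc del:
          atLeastAtMost_iff)
  qed (auto simp: letter_action_def e wreath_sym_def)
qed

lemma letter_action_one: "letter_action G m \<one>\<^bsub>wreath_sym G m\<^esub> = id"
  by (auto simp: letter_action_def wreath_sym_def sym_group_def fun_eq_iff)

lemma letter_action_inverse:
  assumes "x \<in> carrier (wreath_sym G m)"
  shows "letter_action G m (inv\<^bsub>wreath_sym G m\<^esub> x) \<circ> letter_action G m x = id"
    "letter_action G m x \<circ> letter_action G m (inv\<^bsub>wreath_sym G m\<^esub> x) = id"
proof -
  interpret W: group "wreath_sym G m" by (rule group_wreath_sym) (rule group_axioms)
  show "letter_action G m (inv\<^bsub>wreath_sym G m\<^esub> x) \<circ> letter_action G m x = id"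
    "letter_action G m x \<circ> letter_action G m (inv\<^bsub>wreath_sym G m\<^esub> x) = id"
    using assms by (simp_all add: letter_action_one flip: letter_action_mult)
qed

lemma letter_action_inj: "inj_on (letter_action G m) (carrier (wreath_sym G m))"
proof (rule inj_onI)
  fix x y assume xy: "x \<in> carrier (wreath_sym G m)" "y \<in> carrier (wreath_sym G m)"
    "letter_action G m x = letter_action G m y"
  obtain g \<sigma> h \<tau> where e: "x = (g, \<sigma>)" "y = (h, \<tau>)" by (metis surj_pair)
  have x: "g \<in> {1..m} \<rightarrow>\<^sub>E carrier G" "\<sigma> permutes {1..m}"
    and y: "h \<in> {1..m} \<rightarrow>\<^sub>E carrier G" "\<tau> permutes {1..m}"
    using xy by (simp_all only: e carrier_wreath_sym)
  have eq: "\<sigma> i = \<tau> i \<and> g (\<sigma> i) = h (\<sigma> i)" if i: "i \<in> {1..m}" for i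
  proof -
    have "\<sigma> i \<in> {1..m}" "\<tau> i \<in> {1..m}"
      using i permutes_in_image[OF x(2)] permutes_in_image[OF y(2)] by blast+
    then have "g (\<sigma> i) \<in> carrier G" "h (\<tau> i) \<in> carrier G"
      using x(1) y(1) by (meson PiE_mem)+
    then show ?thesis
      using i fun_cong[OF xy(3), of "(i, \<one>)"] by (auto simp: letter_action_def e)
  qed
  have "\<sigma> = \<tau>"
  proof
    fix i show "\<sigma> i = \<tau> i"
      using eq x(2) y(2) by (cases "i \<in> {1..m}") (auto simp: permutes_def)
  qed
  moreover have "g = h"
  proof (rule PiE_ext[OF x(1) y(1)])
    fix i assume "i \<in> {1..m}"
    then obtain j where j: "j \<in> {1..m}" "i = \<sigma> j" using permutes_image[OF x(2)] by blast
    show "g i = h i" unfolding j(2) by (rule conjunct2[OF eq[OF j(1)]])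
  qed
  ultimately show "x = y" by (simp add: e)
qed

lemma bijective_rep_letter_action: "bijective_rep (wreath_sym G m) (letter_action G m)"
proof -
  interpret W: group "wreath_sym G m" by (rule group_wreath_sym) (rule group_axioms)
  show ?thesis
    by unfold_locales (auto simp: letter_action_mult letter_action_inj
        intro: o_bij[OF letter_action_inverse])
qed

lemma letter_action_incl:
  assumes "x \<in> carrier (wreath_sym G m)"
  shows "letter_action G (Suc m) (wreath_sym_incl G m x) = letter_action G m x"
proof
  fix l :: "nat \<times> 'a"
  obtain g \<sigma> i a where e: "x = (g, \<sigma>)" "l = (i, a)" by (metis surj_pair)
  have \<sigma>: "\<sigma> permutes {1..m}" using assms by (simp only: e carrier_wreath_sym)
  have "\<sigma> (Suc m) = Suc m" using \<sigma> by (auto simp: permutes_def)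
  moreover have "\<sigma> i \<noteq> Suc m" if "i \<in> {1..m}"
  proof -
    have "\<sigma> i \<in> {1..m}" using that permutes_in_image[OF \<sigma>] by blast
    then show ?thesis by auto
  qed
  ultimately show "letter_action G (Suc m) (wreath_sym_incl G m x) l = letter_action G m x l"
    by (auto simp: letter_action_def wreath_sym_incl_def e le_Suc_eq)
qed

lemma letter_groups_wreath:
  "letter_groups (carrier G) \<one> (\<lambda>m. letter_action G m ` carrier (wreath_sym G m))"
proof
  fix m and s t :: "nat \<times> 'a \<Rightarrow> nat \<times> 'a" and l l' :: "nat \<times> 'a"
  let ?S = "\<lambda>m. letter_action G m ` carrier (wreath_sym G m)"
  interpret W: group "wreath_sym G m" by (rule group_wreath_sym) (rule group_axioms)
  show "\<one> \<in> carrier G" by simp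
  show "id \<in> ?S m" using letter_action_one[of m] W.one_closed by (metis image_iff)
  show "?S m \<subseteq> ?S (Suc m)"
  proof (rule image_subsetI)
    fix x assume x: "x \<in> carrier (wreath_sym G m)"
    show "letter_action G m x \<in> ?S (Suc m)"
      unfolding letter_action_incl[OF x, symmetric]
      by (intro imageI hom_in_carrier[OF wreath_sym_incl_hom[OF group_axioms] x])
  qed
  show "\<exists>s\<in>?S (Suc (Suc m)). (\<forall>l. fst l \<le> m \<longrightarrow> s l = l) \<and> s (Suc m, \<one>) = (Suc (Suc m), \<one>)"
  proof -
    let ?x = "(\<lambda>i\<in>{1..Suc (Suc m)}. \<one>, transpose (Suc m) (Suc (Suc m)))"
    have "?x \<in> carrier (wreath_sym G (Suc (Suc m)))"
      by (auto simp: carrier_wreath_sym intro!: permutes_swap_id)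
    moreover have "letter_action G (Suc (Suc m)) ?x l = l" if "fst l \<le> m" for l
      using that by (cases l) (auto simp: letter_action_def transpose_def)
    moreover have "letter_action G (Suc (Suc m)) ?x (Suc m, \<one>) = (Suc (Suc m), \<one>)"
      by (simp add: letter_action_def)
    ultimately show ?thesis by blast
  qed
  {
    assume "s \<in> ?S m" "t \<in> ?S m"
    then show "s \<circ> t \<in> ?S m"
      by (auto intro!: image_eqI simp flip: letter_action_mult)
  }
  {
    assume "l \<in> {1..Suc m} \<times> carrier G"
    then obtain i a where l: "l = (i, a)" "i \<in> {1..Suc m}" "a \<in> carrier G" by auto
    let ?x = "(\<lambda>k\<in>{1..Suc m}. if k = Suc m then inv a else \<one>, transpose i (Suc m))"
    have "?x \<in> carrier (wreath_sym G (Suc m))"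
      using l by (auto simp: carrier_wreath_sym intro!: permutes_swap_id)
    moreover have "letter_action G (Suc m) ?x l = (Suc m, \<one>)"
      using l by (simp add: letter_action_def)
    ultimately show "\<exists>s\<in>?S (Suc m). s l = (Suc m, \<one>)" by blast
  }
  {
    assume s: "s \<in> ?S (Suc m)" "s (Suc m, \<one>) = (Suc m, \<one>)"
    then obtain g \<sigma> where x: "(g, \<sigma>) \<in> carrier (wreath_sym G (Suc m))"
        "s = letter_action G (Suc m) (g, \<sigma>)"
      by auto
    then have g: "g \<in> {1..Suc m} \<rightarrow>\<^sub>E carrier G" "\<sigma> permutes {1..Suc m}"
      by (simp_all only: carrier_wreath_sym)
    have gm: "g (Suc m) \<in> carrier G" using g(1) by (rule PiE_mem) simp
    have \<sigma>: "\<sigma> (Suc m) = Suc m" and g1: "g (Suc m) = \<one>"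
      using s(2) gm by (auto simp: x(2) letter_action_def)
    have "\<sigma> permutes {1..m}"
    proof (rule permutes_superset[OF g(2)])
      fix k assume "k \<in> {1..Suc m} - {1..m}"
      then have "k = Suc m" by auto
      then show "\<sigma> k = k" using \<sigma> by simp
    qed
    moreover have "restrict g {1..m} \<in> {1..m} \<rightarrow>\<^sub>E carrier G" using g(1) by auto
    ultimately have y: "(restrict g {1..m}, \<sigma>) \<in> carrier (wreath_sym G m)"
      by (simp only: carrier_wreath_sym)
    have "(restrict g {1..m})(Suc m := \<one>) = g"
      using g(1) g1 by (auto simp: fun_eq_iff PiE_iff extensional_def le_Suc_eq)
    then have "s = letter_action G m (restrict g {1..m}, \<sigma>)"
      using letter_action_incl[OF y] x(2) by (simp add: wreath_sym_incl_def)
    then show "s \<in> ?S m" using y by blast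
  }
  {
    assume s: "s \<in> ?S m"
    then obtain x where x: "x \<in> carrier (wreath_sym G m)" "s = letter_action G m x" by blast
    show "\<exists>t\<in>?S m. t \<circ> s = id \<and> s \<circ> t = id"
      using letter_action_inverse[OF x(1)] x
          by (intro bexI[of _ "letter_action G m (inv\<^bsub>wreath_sym G m\<^esub> x)"]) auto
    show "s l = l" if "fst l \<notin> {1..m}"
      using that by (cases l; cases x) (auto simp: x letter_action_def)
    obtain g \<sigma> where e: "x = (g, \<sigma>)" by force
    have g: "g \<in> {1..m} \<rightarrow>\<^sub>E carrier G" "\<sigma> permutes {1..m}"
      using x by (simp_all only: e carrier_wreath_sym)
    show "s l \<in> {1..m} \<times> carrier G" if l: "l \<in> {1..m} \<times> carrier G"
    proof -
      obtain i a where ia: "l = (i, a)" "i \<in> {1..m}" "a \<in> carrier G" using l by auto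
      have \<sigma>i: "\<sigma> i \<in> {1..m}" using ia permutes_in_image[OF g(2)] by blast
      then have "g (\<sigma> i) \<in> carrier G" using g(1) by (meson PiE_mem)
      then show ?thesis using \<sigma>i ia by (simp add: x(2) e letter_action_def)
    qed
    show "fst l = fst l'"
      if "l \<in> {1..m} \<times> carrier G" "l' \<in> {1..m} \<times> carrier G" "fst (s l) = fst (s l')"
    proof -
      have "fst (s k) = \<sigma> (fst k)" if "k \<in> {1..m} \<times> carrier G" for k
        using that by (cases k) (simp add: x(2) e letter_action_def)
      then have "\<sigma> (fst l) = \<sigma> (fst l')" using that by simp
      then show ?thesis using permutes_inj[OF g(2)] by (simp add: inj_eq)
    qed
  }
qed

text \<open>
  On tuples stabilisation is the identity, because the inclusion does not change the action on letters.
\<close>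
lemma of_bar_incl:
  assumes "b \<in> free_chains (tuples q (carrier (wreath_sym G m)))"
  shows "bijective_rep.of_bar (wreath_sym G (Suc m)) (letter_action G (Suc m)) (bar_chain_map
      (wreath_sym_incl G m) b)
    = bijective_rep.of_bar (wreath_sym G m) (letter_action G m) b"
proof -
  let ?\<Gamma> = "wreath_sym G m" and ?\<Gamma>' = "wreath_sym G (Suc m)" and ?f = "wreath_sym_incl G m"
  interpret W: bijective_rep ?\<Gamma> "letter_action G m" by (rule bijective_rep_letter_action)
  interpret W': bijective_rep ?\<Gamma>' "letter_action G (Suc m)" by (rule bijective_rep_letter_action)
  have hom: "?f \<in> hom ?\<Gamma> ?\<Gamma>'" by (rule wreath_sym_incl_hom) (rule group_axioms)
  have pp: "map (letter_action G (Suc m)) (partial_products ?\<Gamma>' (?f x) (map ?f gs))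
      = map (letter_action G m) (partial_products ?\<Gamma> x gs)"
    if "x \<in> carrier ?\<Gamma>" "set gs \<subseteq> carrier ?\<Gamma>" for x gs
    using that
  proof (induction gs arbitrary: x)
    case (Cons g gs)
    then have "?f x \<otimes>\<^bsub>?\<Gamma>'\<^esub> ?f g = ?f (x \<otimes>\<^bsub>?\<Gamma>\<^esub> g)" using hom_mult[OF hom] by simp
    then show ?case using Cons by (simp add: letter_action_incl)
  qed (simp add: letter_action_incl)
  have one: "?f \<one>\<^bsub>?\<Gamma>\<^esub> = \<one>\<^bsub>?\<Gamma>'\<^esub>"
    using hom_one[OF hom] W.group_axioms W'.group_axioms by blast
  show ?thesis
    unfolding W.of_bar_def W'.of_bar_def bar_chain_map_def frag_extend_frag_extend
    using assms
  proof (rule frag_extend_chains_cong)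
    fix gs assume "gs \<in> tuples q (carrier ?\<Gamma>)"
    then show "frag_extend (\<lambda>gs. frag_of (map (letter_action G (Suc m)) (partial_products ?\<Gamma>' \<one>\<^bsub>?\<Gamma>'\<^esub>
        gs)))
        (frag_of (map ?f gs)) = frag_of (map (letter_action G m) (partial_products ?\<Gamma> \<one>\<^bsub>?\<Gamma>\<^esub> gs))"
      using pp[OF W.one_closed, of gs] by (simp add: one tuples_def)
  qed
qed

end

section \<open>Homological stability\<close>

theorem proposition1p6:
  fixes G :: "('a, 'b) monoid_scheme" and n i :: nat
  assumes "group G"
  shows "(n \<ge> 2 * i + 1 \<longrightarrow>
            group_homology_map i (wreath_sym G (n + 1)) (wreath_sym_incl G n)
              \<in> iso (group_homology i (wreath_sym G n)) (group_homology i (wreath_sym G (n + 1)))) \<and>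
         (n = 2 * i \<longrightarrow>
            group_homology_map i (wreath_sym G (n + 1)) (wreath_sym_incl G n)
              \<in> epi (group_homology i (wreath_sym G n)) (group_homology i (wreath_sym G (n + 1))))"
proof -
  interpret group G by fact
  let ?\<Gamma> = "wreath_sym G n" and ?\<Gamma>' = "wreath_sym G (Suc n)" and ?f = "wreath_sym_incl G n"
  interpret W: bijective_rep ?\<Gamma> "letter_action G n" by (rule bijective_rep_letter_action)
  interpret W': bijective_rep ?\<Gamma>' "letter_action G (Suc n)" by (rule bijective_rep_letter_action)
  interpret S: letter_groups "carrier G" "\<one>\<^bsub>G\<^esub>" "\<lambda>m. letter_action G m ` carrier (wreath_sym G m)"
    by (rule letter_groups_wreath)
  have hom: "?f \<in> hom ?\<Gamma> ?\<Gamma>'" by (rule wreath_sym_incl_hom[OF assms])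
  have frame_nulls: "S.frame_nulls n = W.rep_nulls" "S.frame_nulls (Suc n) = W'.rep_nulls"
      by (simp_all only: S.frame_nulls_def)
  have frame_nulls_mono: "S.frame_nulls n \<subseteq> S.frame_nulls (Suc n)"
    unfolding S.frame_nulls_def using S.S_Suc[of n] nulls_mono by blast
  have surj: "group_homology_map i ?\<Gamma>' ?f \<in> epi (group_homology i ?\<Gamma>) (group_homology i ?\<Gamma>')"
      if "2 * i \<le> n"
  proof (rule group_homology_map_epiI[OF hom])
    fix w assume "w \<in> bar_cycles ?\<Gamma>' i"
    then have w: "w \<in> free_chains (tuples i (carrier ?\<Gamma>'))" "bar_boundary ?\<Gamma>' w = 0"
      by (auto simp: bar_cycles_def)
    let ?c = "W'.of_bar w"
    have c: "?c \<in> frame_chains i" by (rule W'.of_bar_closed[OF w(1)])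
    have "- bd ?c \<in> S.frame_nulls (Suc n)"
      using W'.bd_of_bar[OF w(1)] by (simp add: frame_nulls w(2) W'.of_bar_def)
    then have "bd ?c \<in> S.frame_nulls (Suc n)"
        using S.frame_nulls_diff[OF S.frame_nulls_0, of "- bd ?c" "Suc n"] by simp
    moreover have range: "S.stab_surjective n i" using S.stability that by blast
    ultimately obtain c' b where c': "c' \<in> frame_chains i" "bd c' \<in> S.frame_nulls n"
        and b: "b \<in> frame_chains (Suc i)" "?c - c' - bd b \<in> S.frame_nulls (Suc n)"
      using range[unfolded S.stab_surjective_def] c by blast
    let ?z = "W.to_bar c'"
    have z: "?z \<in> free_chains (tuples i (carrier ?\<Gamma>))" by (rule W.to_bar_closed[OF c'(1)])
    have "bar_boundary ?\<Gamma> ?z = 0"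
      using W.bar_boundary_to_bar[OF frame_chains_frames[OF c'(1)]] W.to_bar_null[of "bd c'"] c'(2)
          frame_nulls by simp
    then have cycle: "?z \<in> bar_cycles ?\<Gamma> i" using z by (simp add: bar_cycles_def)
    obtain b' where b': "b' \<in> frame_chains (Suc i)" "c' - W.of_bar ?z - bd b' \<in> S.frame_nulls n"
      using W.of_bar_to_bar[OF c'(1)] c'(2) frame_nulls by auto
    have fz: "W'.of_bar (bar_chain_map ?f ?z) = W.of_bar ?z" by (rule of_bar_incl[OF z])
    have fz_chain: "bar_chain_map ?f ?z \<in> free_chains (tuples i (carrier ?\<Gamma>'))"
      using bar_chain_map_closed[OF hom] z by (simp only: carrier_bar_chain_group)
    have "?c - W.of_bar ?z - bd (b + b') = (?c - c' - bd b) + (c' - W.of_bar ?z - bd b')"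
      by (simp add: frag_linear)
    moreover have "\<dots> \<in> S.frame_nulls (Suc n)"
        by (rule S.frame_nulls_add[OF b(2) subsetD[OF frame_nulls_mono b'(2)]])
    ultimately have "?c - W.of_bar ?z - bd (b + b') \<in> S.frame_nulls (Suc n)" by (simp only:)
    then have "W'.to_bar (?c - W.of_bar ?z - bd (b + b')) = 0"
      by (intro W'.to_bar_null) (simp only: frame_nulls)
    then have "w - bar_chain_map ?f ?z - W'.to_bar (bd (b + b')) = 0"
      using W'.to_bar_of_bar[OF w(1)] W'.to_bar_of_bar[OF fz_chain]
      by (simp add: W'.to_bar_def frag_extend_diff fz)
    moreover have bb: "b + b' \<in> frame_chains (Suc i)" by (rule frame_chains_add[OF b(1) b'(1)])
    ultimately have "w - bar_chain_map ?f ?z = bar_boundary ?\<Gamma>' (W'.to_bar (b + b'))"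
      using W'.bar_boundary_to_bar[OF frame_chains_frames[OF bb]] by simp
    then have "w - bar_chain_map ?f ?z \<in> bar_boundaries ?\<Gamma>' i"
      unfolding bar_boundaries_iff using W'.to_bar_closed[OF bb] by blast
    then show "\<exists>z\<in>bar_cycles ?\<Gamma> i. w - bar_chain_map ?f z \<in> bar_boundaries ?\<Gamma>' i"
      using cycle by blast
  qed
  have inj: "group_homology_map i ?\<Gamma>' ?f \<in> mon (group_homology i ?\<Gamma>) (group_homology i ?\<Gamma>')"
      if "2 * i + 1 \<le> n"
  proof (rule group_homology_map_monI[OF hom])
    fix z assume "z \<in> bar_cycles ?\<Gamma> i" and fz: "bar_chain_map ?f z \<in> bar_boundaries ?\<Gamma>' i"
    then have z: "z \<in> free_chains (tuples i (carrier ?\<Gamma>))" "bar_boundary ?\<Gamma> z = 0"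
      by (auto simp: bar_cycles_def)
    obtain b0 where b0: "b0 \<in> free_chains (tuples (Suc i) (carrier ?\<Gamma>'))"
        "bar_chain_map ?f z = bar_boundary ?\<Gamma>' b0"
      using fz by (auto simp: bar_boundaries_iff)
    let ?c = "W.of_bar z"
    have c: "?c \<in> frame_chains i" by (rule W.of_bar_closed[OF z(1)])
    have "- bd ?c \<in> S.frame_nulls n"
      using W.bd_of_bar[OF z(1)] by (simp add: frame_nulls z(2) W.of_bar_def)
    then have "bd ?c \<in> S.frame_nulls n" using S.frame_nulls_diff[OF S.frame_nulls_0, of "- bd ?c" n]
        by simp
    moreover have "?c - bd (W'.of_bar b0) \<in> S.frame_nulls (Suc n)"
      using W'.bd_of_bar[OF b0(1)] of_bar_incl[OF z(1)] by (simp add: frame_nulls b0(2))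
    moreover have range: "S.stab_injective n i" using S.stability that by blast
    moreover have "W'.of_bar b0 \<in> frame_chains (Suc i)" by (rule W'.of_bar_closed[OF b0(1)])
    ultimately obtain b where b: "b \<in> frame_chains (Suc i)" "?c - bd b \<in> S.frame_nulls n"
      using range[unfolded S.stab_injective_def] c by blast
    have "W.to_bar (?c - bd b) = 0" using b(2) by (intro W.to_bar_null) (simp only: frame_nulls)
    then have "z = bar_boundary ?\<Gamma> (W.to_bar b)"
      using W.to_bar_of_bar[OF z(1)] W.bar_boundary_to_bar[OF frame_chains_frames[OF b(1)]]
      by (simp add: W.to_bar_def frag_extend_diff)
    then show "z \<in> bar_boundaries ?\<Gamma> i"
      unfolding bar_boundaries_iff using W.to_bar_closed[OF b(1)] by blast
  qed
  show ?thesis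
  proof (intro conjI impI)
    assume "2 * i + 1 \<le> n"
    then show "group_homology_map i (wreath_sym G (n + 1)) ?f
        \<in> iso (group_homology i ?\<Gamma>) (group_homology i (wreath_sym G (n + 1)))"
      unfolding iso_iff_mon_epi using surj inj by simp
  next
    assume "n = 2 * i"
    then show "group_homology_map i (wreath_sym G (n + 1)) ?f
        \<in> epi (group_homology i ?\<Gamma>) (group_homology i (wreath_sym G (n + 1)))"
      using surj by (simp only: Suc_eq_plus1[symmetric])
  qed
qed

end
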